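(* Let $p$ be a prime and let $G$ be a finite $p$-group such that $G_3\cong C_p$, $\Phi(G')=1$ and $G/G_3\cong M_p(n,m,1)$, where $n\ge m$, and $n>1$ if $p=2$. Then: (1) If $m=1$, then $I_{\min}=1$. (2) If $m\ge2$, then $I_{\min}=2$.
   Context: All groups are finite $p$-groups; $G_3=[G',G]$, $\Phi(H)$ is the Frattini subgroup of $H$, $[x,y]=x^{-1}y^{-1}xy$. An $\mathcal{A}_1$-group is a minimal non-abelian $p$-group. For a finite non-abelian $p$-group $G$, $p^{I_{\min}}$ denotes the minimal index in $G$ of the $\mathcal{A}_1$-subgroups of $G$. For $n\ge m\ge 1$ (with $n>1$ if $p=2$), $M_p(n,m,1)=\langle a,b,c\mid a^{p^n}=b^{p^m}=c^p=1,\ [a,b]=c,\ [c,a]=[c,b]=1\rangle$. *)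

theory Defs
  imports "HOL-Algebra.Algebra" "HOL-Computational_Algebra.Primes"
begin

section \<open>Groups given by generators and relations\<close>

text \<open>A letter \<open>(x, True)\<close> stands for the generator \<open>x\<close>, and \<open>(x, False)\<close> for its formal
  inverse. A relation \<open>u = v\<close> between words is the pair \<open>(u, v)\<close>. The group presented by the
  relations \<open>R\<close> on the generators of type \<open>'g\<close> is the set of all words modulo the least
  congruence that contains free cancellation and the relations.\<close>

type_synonym 'g word = "('g \<times> bool) list"

inductive pres_eq :: "('g word \<times> 'g word) set \<Rightarrow> 'g word \<Rightarrow> 'g word \<Rightarrow> bool"
  for R :: "('g word \<times> 'g word) set" where
  refl: "pres_eq R u u"
| sym: "pres_eq R u v \<Longrightarrow> pres_eq R v u"
| trans: "pres_eq R u v \<Longrightarrow> pres_eq R v w \<Longrightarrow> pres_eq R u w"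
| append: "pres_eq R u u' \<Longrightarrow> pres_eq R v v' \<Longrightarrow> pres_eq R (u @ v) (u' @ v')"
| cancel: "pres_eq R [(x, e), (x, \<not> e)] []"
| rel: "(u, v) \<in> R \<Longrightarrow> pres_eq R u v"

definition pres_rel :: "('g word \<times> 'g word) set \<Rightarrow> 'g word rel" where
  "pres_rel R = {(u, v). pres_eq R u v}"

definition presented_group :: "('g word \<times> 'g word) set \<Rightarrow> 'g word set monoid" where
  "presented_group R =
     \<lparr>carrier = UNIV // pres_rel R,
      monoid.mult = (\<lambda>A B. pres_rel R `` {u @ v | u v. u \<in> A \<and> v \<in> B}),
      monoid.one = pres_rel R `` {[]}\<rparr>"

lemma equiv_pres_rel: "equiv UNIV (pres_rel R)"
  unfolding equiv_def refl_on_def sym_on_def trans_on_def pres_rel_def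
  by (auto intro: pres_eq.intros)

lemma pres_class_eq_iff:
  "pres_rel R `` {u} = pres_rel R `` {v} \<longleftrightarrow> pres_eq R u v"
  using eq_equiv_class_iff[OF equiv_pres_rel, of u v R] by (simp add: pres_rel_def)

lemma mult_presented_group:
  "pres_rel R `` {u} \<otimes>\<^bsub>presented_group R\<^esub> pres_rel R `` {v} = pres_rel R `` {u @ v}"
  unfolding presented_group_def pres_rel_def
  by (auto intro: pres_eq.refl pres_eq.trans[OF pres_eq.append])

lemma group_presented_group: "group (presented_group R)"
proof -
  have car: "A \<in> carrier (presented_group R) \<longleftrightarrow> (\<exists>u. A = pres_rel R `` {u})" for A
    by (auto simp: presented_group_def quotient_def)
  have one: "\<one>\<^bsub>presented_group R\<^esub> = pres_rel R `` {[]}"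
    by (simp add: presented_group_def)
  have inv: "\<exists>v. pres_eq R (v @ u) []" for u :: "'a word"
  proof (induction u)
    case Nil
    show ?case by (auto intro: exI[of _ "[]"] pres_eq.refl)
  next
    case (Cons a u)
    then obtain v where v: "pres_eq R (v @ u) []" by blast
    obtain x e where a: "a = (x, e)" by (cases a)
    have "pres_eq R ([(x, \<not> e), (x, e)] @ u) ([] @ u)"
      using pres_eq.append[OF pres_eq.cancel[of R x "\<not> e"] pres_eq.refl[of R u]] by simp
    from pres_eq.append[OF pres_eq.refl[of R v] this]
    have "pres_eq R ((v @ [(x, \<not> e)]) @ (a # u)) (v @ u)"
      by (simp add: a)
    then show ?case using v by (blast intro: pres_eq.trans)
  qed
  show ?thesis
  proof (rule groupI)
    fix A assume "A \<in> carrier (presented_group R)"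
    then obtain u where u: "A = pres_rel R `` {u}" by (auto simp: car)
    obtain v where "pres_eq R (v @ u) []" using inv by blast
    then have "pres_rel R `` {v} \<otimes>\<^bsub>presented_group R\<^esub> A = \<one>\<^bsub>presented_group R\<^esub>"
      by (simp add: u one mult_presented_group pres_class_eq_iff)
    then show "\<exists>B \<in> carrier (presented_group R).
        B \<otimes>\<^bsub>presented_group R\<^esub> A = \<one>\<^bsub>presented_group R\<^esub>"
      using car by blast
  qed (auto simp: car one mult_presented_group)
qed

datatype gen_abc = gen_a | gen_b | gen_c

text \<open>The fourth relation is \<open>[a,b] = c\<close> with \<open>[x,y] = x\<^sup>-\<^sup>1 y\<^sup>-\<^sup>1 x y\<close>.\<close>

definition M_pres :: "nat \<Rightarrow> nat \<Rightarrow> nat \<Rightarrow> gen_abc word set monoid" where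
  "M_pres p n m =
    (let a = (gen_a, True); b = (gen_b, True); c = (gen_c, True);
         a' = (gen_a, False); b' = (gen_b, False); c' = (gen_c, False)
     in presented_group
       {(replicate (p ^ n) a, []),
        (replicate (p ^ m) b, []),
        (replicate p c, []),
        ([a', b', a, b], [c]),
        ([c', a', c, a], []),
        ([c', b', c, b], [])})"

section \<open>Finite p-groups and their subgroups\<close>

definition finite_p_group :: "nat \<Rightarrow> ('a, 'b) monoid_scheme \<Rightarrow> bool" where
  "finite_p_group p G \<longleftrightarrow> group G \<and> finite (carrier G) \<and> (\<exists>k. order G = p ^ k)"

definition commutator :: "('a, 'b) monoid_scheme \<Rightarrow> 'a \<Rightarrow> 'a \<Rightarrow> 'a" where
  "commutator G x y = inv\<^bsub>G\<^esub> x \<otimes>\<^bsub>G\<^esub> inv\<^bsub>G\<^esub> y \<otimes>\<^bsub>G\<^esub> x \<otimes>\<^bsub>G\<^esub> y"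

definition commutator_subgroup ::
    "('a, 'b) monoid_scheme \<Rightarrow> 'a set \<Rightarrow> 'a set \<Rightarrow> 'a set" where
  "commutator_subgroup G H K = generate G {commutator G h k | h k. h \<in> H \<and> k \<in> K}"

text \<open>\<open>derived\<close> is generated by the elements \<open>x y x\<^sup>-\<^sup>1 y\<^sup>-\<^sup>1\<close>, which yield the same subgroup \<open>G'\<close>
  as the commutators \<open>x\<^sup>-\<^sup>1 y\<^sup>-\<^sup>1 x y\<close>.\<close>

definition G3 :: "('a, 'b) monoid_scheme \<Rightarrow> 'a set" where
  "G3 G = commutator_subgroup G (derived G (carrier G)) (carrier G)"

definition maximal_subgroup :: "'a set \<Rightarrow> ('a, 'b) monoid_scheme \<Rightarrow> bool" where
  "maximal_subgroup M G \<longleftrightarrow> subgroup M G \<and> M \<noteq> carrier G \<and>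
     (\<forall>H. subgroup H G \<longrightarrow> M \<subseteq> H \<longrightarrow> H = M \<or> H = carrier G)"

definition frattini :: "('a, 'b) monoid_scheme \<Rightarrow> 'a set" where
  "frattini G = carrier G \<inter> \<Inter> {M. maximal_subgroup M G}"

definition A1_group :: "nat \<Rightarrow> ('a, 'b) monoid_scheme \<Rightarrow> bool" where
  "A1_group p G \<longleftrightarrow> finite_p_group p G \<and> \<not> comm_group G \<and>
     (\<forall>K. subgroup K G \<longrightarrow> K \<noteq> carrier G \<longrightarrow> comm_group (G\<lparr>carrier := K\<rparr>))"

definition min_A1_index :: "nat \<Rightarrow> ('a, 'b) monoid_scheme \<Rightarrow> nat" where
  "min_A1_index p G =
     (LEAST k. \<exists>H. subgroup H G \<and> A1_group p (G\<lparr>carrier := H\<rparr>) \<and> k = card (rcosets\<^bsub>G\<^esub> H))"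

text \<open>Meaningful for finite non-abelian \<open>p\<close>-groups, where \<open>\<A>\<^sub>1\<close>-subgroups exist and indices are
  powers of \<open>p\<close>.\<close>

definition I_min :: "nat \<Rightarrow> ('a, 'b) monoid_scheme \<Rightarrow> nat" where
  "I_min p G = (THE i. p ^ i = min_A1_index p G)"

end

theory Submission
  imports Defs "HOL-Number_Theory.Residues"
begin

text \<open>Write \<open>D\<close> for the derived subgroup and let \<open>x, y\<close> generate \<open>G\<close>, \<open>c = [x, y]\<close>. The
  group \<open>G\<^sub>3\<close> is central of order \<open>p\<close> and \<open>D = \<langle>c\<rangle> G\<^sub>3\<close> has exponent \<open>p\<close>. Two elements whose
  commutator has order \<open>p\<close> and commutes with both generate an \<open>\<A>\<^sub>1\<close>-group.

  Upper bounds: if \<open>c\<close> does not commute with \<open>x\<close> and \<open>y\<^sup>p \<in> G\<^sub>3\<close>, as can be arranged for \<open>m = 1\<close>,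
  then \<open>\<langle>x, c\<rangle>\<close> has index at most \<open>p\<close>. In general \<open>y\<close> can be chosen in the centraliser of \<open>D\<close>, and
  then \<open>\<langle>x, c y\<^sup>p\<rangle>\<close> has index at most \<open>p\<^sup>2\<close>.

  Lower bounds: \<open>G\<close> itself is not an \<open>\<A>\<^sub>1\<close>-group, having class 3. For \<open>m \<ge> 2\<close>, an
  \<open>\<A>\<^sub>1\<close>-subgroup \<open>H\<close> of index \<open>p\<close> would contain \<open>D\<close> and all \<open>p\<close>-th powers. As \<open>G/G\<^sub>3\<close> is an
  \<open>\<A>\<^sub>1\<close>-group, \<open>H/G\<^sub>3\<close> is abelian, and it is generated by two elements, so at most \<open>p\<^sup>2\<close> of its
  elements satisfy \<open>g\<^sup>p = 1\<close>. But it contains an elementary abelian group of order \<open>p\<^sup>3\<close>.\<close>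

section \<open>Pairs generating a group of class two\<close>

lemma (in group) conj_int_pow:
  assumes "g \<in> carrier G" "x \<in> carrier G"
  shows "(g \<otimes> x \<otimes> inv g) [^] (i::int) = g \<otimes> x [^] i \<otimes> inv g"
proof -
  have "(\<lambda>x. g \<otimes> x \<otimes> inv g) \<in> hom G G"
    using assms(1) by (auto simp: hom_def m_assoc inv_solve_left)
  from hom_int_pow[OF this assms(2) group_axioms group_axioms] show ?thesis by simp
qed

text \<open>An element commutes with \<open>u\<close> exactly when conjugation by it fixes
  \<open>u\<close>. Conjugation respects powers, so commuting passes to a power of one element and
  then to a power of the other.\<close>

lemma (in group) int_pow_commute:
  assumes "x \<otimes> y = y \<otimes> x" "x \<in> carrier G" "y \<in> carrier G"
  shows "x [^] (i::int) \<otimes> y [^] (j::int) = y [^] j \<otimes> x [^] i"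
proof -
  have *: "u [^] (k::int) \<otimes> v = v \<otimes> u [^] k"
    if "u \<otimes> v = v \<otimes> u" "u \<in> carrier G" "v \<in> carrier G" for u v k
  proof -
    have "v \<otimes> u \<otimes> inv v = u"
      using that by (metis inv_solve_right m_closed)
    with conj_int_pow[of v u k] that have "v \<otimes> u [^] k \<otimes> inv v = u [^] k" by simp
    then show ?thesis using that by (metis int_pow_closed inv_solve_right m_closed)
  qed
  show ?thesis
    using *[of "y" "x [^] i" j] *[of x y i] assms by simp
qed

lemma (in group) commutator_closed [intro, simp]:
  "x \<in> carrier G \<Longrightarrow> y \<in> carrier G \<Longrightarrow> commutator G x y \<in> carrier G"
  by (simp add: commutator_def)

lemma (in group) mult_commutator:
  assumes "x \<in> carrier G" "y \<in> carrier G"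
  shows "x \<otimes> y = y \<otimes> x \<otimes> commutator G x y"
proof -
  have "commutator G x y = inv (y \<otimes> x) \<otimes> (x \<otimes> y)"
    using assms by (simp add: commutator_def inv_mult_group m_assoc)
  then show ?thesis using assms by (simp flip: m_assoc)
qed

lemma (in group) commutator_unique:
  assumes "x \<in> carrier G" "y \<in> carrier G" "c \<in> carrier G" "x \<otimes> y = y \<otimes> x \<otimes> c"
  shows "commutator G x y = c"
  using mult_commutator[of x y] assms by (metis commutator_closed l_cancel m_closed)

lemma (in group) commutator_eq_one_iff:
  assumes "x \<in> carrier G" "y \<in> carrier G"
  shows "commutator G x y = \<one> \<longleftrightarrow> x \<otimes> y = y \<otimes> x"
  using commutator_unique[of x y \<one>] mult_commutator[of x y] assms by auto

section \<open>Normal forms for a pair with central commutator\<close>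

text \<open>The equation \<open>xy\<close> says that \<open>c\<close> is the commutator of
  \<open>x\<close> and \<open>y\<close>. The subgroup generated by the pair is an image of the
  integral Heisenberg group; \<open>c = \<one>\<close> is allowed and covers commuting
  pairs.\<close>

locale class2_pair = group G for G (structure) +
  fixes x y c
  assumes x_closed [simp, intro]: "x \<in> carrier G" and y_closed [simp, intro]: "y \<in> carrier G"
    and c_closed [simp, intro]: "c \<in> carrier G"
    and xy: "x \<otimes> y = y \<otimes> x \<otimes> c"
    and cx: "c \<otimes> x = x \<otimes> c" and cy: "c \<otimes> y = y \<otimes> c"
begin

lemma cx_pow: "c [^] (k::int) \<otimes> x [^] (i::int) = x [^] i \<otimes> c [^] k"
  by (rule int_pow_commute[OF cx]) auto

lemma cy_pow: "c [^] (k::int) \<otimes> y [^] (j::int) = y [^] j \<otimes> c [^] k"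
  by (rule int_pow_commute[OF cy]) auto

text \<open>Conjugation by \<open>inv x\<close> sends \<open>y\<close> to \<open>y c^(-1)\<close>,
  hence \<open>y^j\<close> to \<open>y^j c^(-j)\<close>. Conjugation by \<open>y^j\<close> therefore
  sends \<open>x\<close> to \<open>x c^(-j)\<close>, hence \<open>x^i\<close> to
  \<open>x^i c^(-ij)\<close>.\<close>

lemma yx_pow: "y [^] (j::int) \<otimes> x [^] (i::int) = x [^] i \<otimes> y [^] j \<otimes> c [^] (- (i * j))"
proof -
  have yx: "y \<otimes> x = x \<otimes> y \<otimes> c [^] (-1::int)"
    using xy by (simp add: int_pow_neg inv_solve_right)
  have 1: "inv x \<otimes> y \<otimes> inv (inv x) = y \<otimes> c [^] (-1::int)"
    using yx by (simp add: m_assoc inv_solve_left')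
  have cy1: "y \<otimes> c [^] (-1::int) = c [^] (-1::int) \<otimes> y"
    using cy_pow[of "-1" 1] by simp
  have "inv x \<otimes> y [^] j \<otimes> inv (inv x) = y [^] j \<otimes> c [^] (- j)"
    using conj_int_pow[of "inv x" y j] int_pow_mult_distrib[OF cy1, of j]
    unfolding 1 by (simp add: int_pow_pow)
  then have "y [^] j \<otimes> x = x \<otimes> y [^] j \<otimes> c [^] (- j)"
    by (simp add: m_assoc inv_solve_left')
  then have 2: "y [^] j \<otimes> x \<otimes> inv (y [^] j) = x \<otimes> c [^] (- j)"
    by (simp add: m_assoc inv_solve_right' flip: cy_pow)
  have cx1: "x \<otimes> c [^] (-j) = c [^] (- j) \<otimes> x"
    using cx_pow[of "-j" 1] by simp
  have "y [^] j \<otimes> x [^] i \<otimes> inv (y [^] j) = x [^] i \<otimes> c [^] (- (i * j))"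
    using conj_int_pow[of "y [^] j" x i] int_pow_mult_distrib[OF cx1, of i]
    by (simp add: 2 int_pow_pow mult.commute)
  then have "y [^] j \<otimes> x [^] i = x [^] i \<otimes> c [^] (- (i * j)) \<otimes> y [^] j"
    by (simp add: inv_solve_right')
  then show ?thesis
    by (simp add: m_assoc cy_pow)
qed

lemma cx_pow': "z \<in> carrier G \<Longrightarrow> c [^] (k::int) \<otimes> (x [^] (i::int) \<otimes> z) = x [^] i \<otimes> (c [^] k \<otimes> z)"
  by (simp add: cx_pow flip: m_assoc)

lemma cy_pow': "z \<in> carrier G \<Longrightarrow> c [^] (k::int) \<otimes> (y [^] (i::int) \<otimes> z) = y [^] i \<otimes> (c [^] k \<otimes> z)"
  by (simp add: cy_pow flip: m_assoc)

lemma yx_pow': "z \<in> carrier G \<Longrightarrow>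
    y [^] (j::int) \<otimes> (x [^] (i::int) \<otimes> z) = x [^] i \<otimes> (y [^] j \<otimes> (c [^] (- (i * j)) \<otimes> z))"
  by (simp add: yx_pow m_assoc flip: m_assoc[of "y [^] j" "x [^] i" z])

lemma int_pow_add: "u \<in> carrier G \<Longrightarrow> u [^] (i::int) \<otimes> u [^] (j::int) = u [^] (i + j)"
  by (simp add: int_pow_mult)

lemma int_pow_add': "u \<in> carrier G \<Longrightarrow> z \<in> carrier G \<Longrightarrow>
    u [^] (i::int) \<otimes> (u [^] (j::int) \<otimes> z) = u [^] (i + j) \<otimes> z"
  by (simp add: int_pow_mult m_assoc)

definition nf :: "int \<Rightarrow> int \<Rightarrow> int \<Rightarrow> 'a" where
  "nf i j k = x [^] i \<otimes> y [^] j \<otimes> c [^] k"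

lemma nf_closed [simp, intro]: "nf i j k \<in> carrier G"
  by (simp add: nf_def)

text \<open>The multiplication of the Heisenberg group: only moving \<open>y^j\<close> past
  \<open>x^r\<close> has a cost, namely \<open>c^(-jr)\<close>.\<close>

lemma nf_mult: "nf i j k \<otimes> nf r s t = nf (i + r) (j + s) (k + t - j * r)"
  by (simp add: nf_def m_assoc cx_pow cx_pow' cy_pow cy_pow' yx_pow yx_pow'
      int_pow_add int_pow_add') (simp add: algebra_simps)

lemma nf_zero: "nf 0 0 0 = \<one>"
  by (simp add: nf_def)

lemma nf_x: "nf 1 0 0 = x" and nf_y: "nf 0 1 0 = y" and nf_c: "nf 0 0 1 = c"
  by (simp_all add: nf_def)

lemma nf_c_pow: "nf 0 0 k = c [^] k"
  by (simp add: nf_def)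

lemma nf_inv: "inv (nf i j k) = nf (- i) (- j) (- k - i * j)"
  by (rule inv_equality) (simp_all add: nf_mult nf_zero)

text \<open>The exponents of \<open>x\<close> and \<open>y\<close> are additive. The exponent of
  \<open>c\<close> is quadratic in \<open>e\<close>; later arguments use only its existence.\<close>

lemma nf_pow: "\<exists>t. nf i j k [^] (e::int) = nf (e * i) (e * j) t"
proof -
  have nat: "\<exists>t. nf i j k [^] (int d) = nf (int d * i) (int d * j) t" for d :: nat
  proof (induction d)
    case 0
    show ?case using nf_zero by (metis int_pow_0 mult_zero_left of_nat_0)
  next
    case (Suc d)
    then obtain t where "nf i j k [^] (int d) = nf (int d * i) (int d * j) t" by blast
    then show ?case
      by (auto simp: int_pow_mult nf_mult distrib_right)
  qed
  show ?thesis
  proof (cases e rule: int_cases2)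
    case (nonneg d)
    then show ?thesis using nat by blast
  next
    case (nonpos d)
    obtain t where "nf i j k [^] (int d) = nf (int d * i) (int d * j) t" using nat by blast
    then show ?thesis by (auto simp: nonpos int_pow_neg nf_inv)
  qed
qed

text \<open>Normal forms are closed under products and inverses and include \<open>x\<close> and
  \<open>y\<close>; conversely \<open>c\<close> is a word in \<open>x\<close> and
  \<open>y\<close>.\<close>

lemma generate_eq_nf: "generate G {x, y} = {nf i j k | i j k. True}"
proof
  have "subgroup {nf i j k | i j k. True} G"
  proof (rule subgroupI)
    show "\<And>a. a \<in> {nf i j k |i j k. True} \<Longrightarrow> inv a \<in> {nf i j k |i j k. True}"
      using nf_inv by blast
    show "\<And>a b. a \<in> {nf i j k |i j k. True} \<Longrightarrow> b \<in> {nf i j k |i j k. True} \<Longrightarrow>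
        a \<otimes> b \<in> {nf i j k |i j k. True}"
      using nf_mult by blast
  qed auto
  moreover have "{x, y} \<subseteq> {nf i j k | i j k. True}"
    using nf_x nf_y by (auto; metis)
  ultimately show "generate G {x, y} \<subseteq> {nf i j k | i j k. True}"
    by (rule generate_subgroup_incl[rotated])
  have sub: "subgroup (generate G {x, y}) G" by (rule generate_is_subgroup) auto
  note mem = subgroup.m_closed[OF sub] subgroup.m_inv_closed[OF sub] subgroup_int_pow_closed[OF sub]
  have xg: "x \<in> generate G {x, y}" and yg: "y \<in> generate G {x, y}"
    by (auto intro: generate.incl)
  have "c = inv (y \<otimes> x) \<otimes> (x \<otimes> y)"
    using xy by (simp add: inv_solve_left)
  with xg yg have cg: "c \<in> generate G {x, y}" by (auto intro: mem)
  show "{nf i j k | i j k. True} \<subseteq> generate G {x, y}"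
    using xg yg cg by (auto simp: nf_def intro!: mem)
qed

end

section \<open>Subgroups of finite p-groups, indices and minimal non-abelian subgroups\<close>

lemma finite_p_groupD:
  assumes "finite_p_group p G"
  shows "group G" "finite (carrier G)" "\<exists>k. order G = p ^ k"
  using assms by (simp_all add: finite_p_group_def)

lemma (in group) finite_p_group_subgroup:
  assumes "Factorial_Ring.prime p" "finite_p_group p G" "subgroup H G"
  shows "finite_p_group p (G\<lparr>carrier := H\<rparr>)"
proof -
  obtain k where k: "order G = p ^ k" using finite_p_groupD(3)[OF assms(2)] by blast
  have "card H dvd p ^ k" using lagrange[OF assms(3)] k by (metis dvd_triv_right)
  then obtain i where "card H = p ^ i" using assms(1) by (auto simp: divides_primepow_nat)
  then show ?thesis
    using subgroup_imp_group[OF assms(3)] assms(2) subgroup.subset[OF assms(3)]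
    by (auto simp: finite_p_group_def order_def intro: finite_subset)
qed

lemma (in group) index_primepow:
  assumes "Factorial_Ring.prime p" "finite_p_group p G" "subgroup H G"
  obtains e where "card (rcosets H) = p ^ e"
proof -
  obtain k where k: "order G = p ^ k" using finite_p_groupD(3)[OF assms(2)] by blast
  have "card (rcosets H) dvd p ^ k" using lagrange[OF assms(3)] k by (metis dvd_triv_left)
  then show ?thesis using assms(1) that by (auto simp: divides_primepow_nat)
qed

lemma (in group) index_one_iff:
  assumes "finite (carrier G)" "subgroup H G"
  shows "card (rcosets H) = 1 \<longleftrightarrow> H = carrier G"
proof
  assume "card (rcosets H) = 1"
  then have "card H = card (carrier G)" using lagrange[OF assms(2)] by (simp add: order_def)
  then show "H = carrier G" using card_subset_eq[OF assms(1) subgroup.subset[OF assms(2)]] by simp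
next
  assume "H = carrier G"
  then show "card (rcosets H) = 1"
    using lagrange[OF assms(2)] assms(1) by (simp add: order_def)
       (metis card_gt_0_iff mult_cancel2 mult_1 neq0_conv one_closed empty_iff)
qed

lemma (in group) comm_group_subgroup_iff:
  assumes "subgroup H G"
  shows "comm_group (G\<lparr>carrier := H\<rparr>) \<longleftrightarrow> (\<forall>u\<in>H. \<forall>v\<in>H. u \<otimes> v = v \<otimes> u)"
proof
  assume "comm_group (G\<lparr>carrier := H\<rparr>)"
  then show "\<forall>u\<in>H. \<forall>v\<in>H. u \<otimes> v = v \<otimes> u"
    using comm_monoid.m_comm[OF comm_group.axioms(1)] by fastforce
next
  assume "\<forall>u\<in>H. \<forall>v\<in>H. u \<otimes> v = v \<otimes> u"
  then show "comm_group (G\<lparr>carrier := H\<rparr>)"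
    by (intro group.group_comm_groupI subgroup_imp_group[OF assms]) simp
qed

lemma (in group) A1_group_subgroup_iff:
  assumes "Factorial_Ring.prime p" "finite_p_group p G" "subgroup H G"
  shows "A1_group p (G\<lparr>carrier := H\<rparr>) \<longleftrightarrow>
    (\<exists>u\<in>H. \<exists>v\<in>H. u \<otimes> v \<noteq> v \<otimes> u) \<and>
    (\<forall>K. subgroup K G \<longrightarrow> K \<subset> H \<longrightarrow> (\<forall>u\<in>K. \<forall>v\<in>K. u \<otimes> v = v \<otimes> u))"
proof -
  have "subgroup K (G\<lparr>carrier := H\<rparr>) \<longleftrightarrow> subgroup K G \<and> K \<subseteq> H" for K
    using incl_subgroup[OF assms(3)] subgroup_incl[OF _ assms(3)]
      subgroup.subset[of K "G\<lparr>carrier := H\<rparr>"] by auto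
  then show ?thesis
    unfolding A1_group_def
    using finite_p_group_subgroup[OF assms] comm_group_subgroup_iff comm_group_subgroup_iff[OF assms(3)]
    by (auto simp: psubset_eq)
qed

text \<open>A non-commuting pair generates a non-abelian subgroup of \<open>H\<close>, which by
  minimality cannot be proper.\<close>

lemma (in group) A1_group_generated_by_noncommuting:
  assumes "Factorial_Ring.prime p" "finite_p_group p G" "subgroup H G" "A1_group p (G\<lparr>carrier := H\<rparr>)"
  obtains u v where "u \<in> H" "v \<in> H" "u \<otimes> v \<noteq> v \<otimes> u" "H = generate G {u, v}"
proof -
  obtain u v where uv: "u \<in> H" "v \<in> H" "u \<otimes> v \<noteq> v \<otimes> u"
    using assms A1_group_subgroup_iff by blast
  have "subgroup (generate G {u, v}) G"
    using uv subgroup.subset[OF assms(3)] by (intro generate_is_subgroup) auto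
  moreover have "generate G {u, v} \<subseteq> H"
    using uv by (intro generate_subgroup_incl assms(3)) auto
  moreover have "u \<in> generate G {u, v}" "v \<in> generate G {u, v}" by (auto intro: generate.incl)
  ultimately have "H = generate G {u, v}"
    using uv(3) A1_group_subgroup_iff[OF assms(1-3)] assms(4) by (metis psubsetI)
  with uv that show ?thesis by blast
qed

text \<open>Bezout's identity. In most uses one exponent is a power of \<open>p\<close> that kills
  \<open>g\<close>, so that an exponent prime to \<open>p\<close> can be divided out.\<close>

lemma (in group) int_pow_coprime_mem:
  assumes "subgroup K G" "g \<in> carrier G" "g [^] (i::int) \<in> K" "g [^] (j::int) \<in> K" "coprime i j"
  shows "g \<in> K"
proof -
  obtain r s where rs: "r * i + s * j = 1" using bezout_int[of i j] assms(5) by auto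
  have "g = g [^] (i * r + j * s)" using rs assms(2) by (simp add: mult.commute)
  also have "\<dots> = (g [^] i) [^] r \<otimes> (g [^] j) [^] s"
    using assms(2) by (simp add: int_pow_mult int_pow_pow)
  also have "\<dots> \<in> K"
    by (simp add: assms subgroup.m_closed[OF assms(1)] subgroup_int_pow_closed[OF assms(1)])
  finally show ?thesis .
qed

section \<open>Minimality of the subgroup generated by the pair\<close>

context class2_pair
begin

text \<open>The commutator of two normal forms is \<open>c\<close> to the determinant of their
  exponents of \<open>x\<close> and \<open>y\<close>.\<close>

lemma nf_commute_iff:
  "nf i j k \<otimes> nf r s t = nf r s t \<otimes> nf i j k \<longleftrightarrow> c [^] (i * s - j * r) = \<one>"
proof -
  have "nf i j k \<otimes> nf r s t = nf r s t \<otimes> nf i j k \<otimes> c [^] (i * s - j * r)"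
    by (simp add: nf_mult algebra_simps flip: nf_c_pow)
  then show ?thesis
    using commutator_unique commutator_eq_one_iff by (metis c_closed int_pow_closed nf_closed)
qed

text \<open>If a subgroup \<open>K\<close> contains two non-commuting normal forms, their
  determinant is prime to \<open>p\<close>. It is then invertible modulo the group order, and
  \<open>c\<close>, \<open>x\<close> and \<open>y\<close> are recovered in \<open>K\<close> in turn,
  so \<open>K\<close> is not proper.\<close>

theorem A1_group_generate:
  assumes p: "Factorial_Ring.prime p" and G: "finite_p_group p G"
    and c1: "c \<noteq> \<one>" and cp: "c [^] p = \<one>"
  shows "A1_group p (G\<lparr>carrier := generate G {x, y}\<rparr>)"
proof -
  let ?H = "generate G {x, y}"
  have sub: "subgroup ?H G" by (rule generate_is_subgroup) auto
  have xH: "x \<in> ?H" and yH: "y \<in> ?H" by (auto intro: generate.incl)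
  have nc: "x \<otimes> y \<noteq> y \<otimes> x" 
    using commutator_unique[OF x_closed y_closed c_closed xy] commutator_eq_one_iff[of x y] c1 by simp
  obtain N where N: "order G = p ^ N" using finite_p_groupD(3)[OF G] by blast
  have ordN: "g [^] (int (p ^ N)) = \<one>" if "g \<in> carrier G" for g
    unfolding int_pow_int using pow_order_eq_1[OF that] N by simp
  have cpow: "c [^] d = \<one>" if "int p dvd d" for d
  proof -
    from that obtain e where "d = int p * e" by (elim dvdE)
    then show ?thesis using cp by (metis c_closed int_pow_int int_pow_one int_pow_pow)
  qed
  have "u \<otimes> v = v \<otimes> u" if K: "subgroup K G" "K \<subset> ?H" and u: "u \<in> K" and v: "v \<in> K" for K u v
  proof (rule ccontr)
    assume neq: "u \<otimes> v \<noteq> v \<otimes> u"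
    obtain i j k where u': "u = nf i j k" using K(2) u unfolding generate_eq_nf by blast
    obtain r s t where v': "v = nf r s t" using K(2) v unfolding generate_eq_nf by blast
    \<comment> \<open>The determinant; since \<open>c^p = \<one>\<close>, it is prime to
      \<open>p\<close> as soon as \<open>u\<close> and \<open>v\<close> do not commute.\<close>
    define D where "D = i * s - j * r"
    have "\<not> int p dvd D" using neq nf_commute_iff cpow unfolding u' v' D_def by blast
    moreover have "Factorial_Ring.prime (int p)" using p by simp
    ultimately have "coprime (int p) D" by (intro prime_imp_coprime)
    then have cop: "coprime D (int (p ^ N))" by (simp add: coprime_commute)
    note mem = subgroup.m_closed[OF K(1)] subgroup.m_inv_closed[OF K(1)] subgroup_int_pow_closed[OF K(1)]
    have one: "\<one> \<in> K" by (rule subgroup.one_closed[OF K(1)])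
    have "c [^] D = inv (v \<otimes> u) \<otimes> (u \<otimes> v)"
      unfolding u' v' D_def by (simp add: nf_mult nf_inv flip: nf_c_pow) (simp add: algebra_simps)
    then have "c [^] D \<in> K" using u v by (simp add: mem)
    then have cK: "c \<in> K" using int_pow_coprime_mem[OF K(1) _ _ _ cop] ordN one by simp
    \<comment> \<open>With \<open>c\<close> in \<open>K\<close>, a power of \<open>c\<close> can be
      stripped off and the exponent \<open>D\<close> divided out.\<close>
    have close: "g \<in> K" if "g [^] D \<otimes> c [^] e \<in> K" "g \<in> carrier G" for g and e :: int
    proof -
      have "g [^] D = (g [^] D \<otimes> c [^] e) \<otimes> inv (c [^] e)" using that(2) by (simp add: m_assoc)
      then have "g [^] D \<in> K" using that cK by (metis mem)
      then show ?thesis using int_pow_coprime_mem[OF K(1) _ _ _ cop] ordN one that(2) by simp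
    qed
    have comb: "\<exists>w. nf (a * i + b * r) (a * j + b * s) w \<in> K" for a b
    proof -
      obtain w w' where "u [^] a = nf (a * i) (a * j) w" "v [^] b = nf (b * r) (b * s) w'"
        using nf_pow unfolding u' v' by metis
      moreover have "u [^] a \<otimes> v [^] b \<in> K" using u v by (simp add: mem)
      ultimately show ?thesis by (auto simp: nf_mult)
    qed
    \<comment> \<open>Cramer's rule: \<open>u^s v^(-j)\<close> has exponents \<open>D\<close> and
      \<open>0\<close> at \<open>x\<close> and \<open>y\<close>, and \<open>u^(-r) v^i\<close> below
      has \<open>0\<close> and \<open>D\<close>.\<close>
    obtain w where "nf (s * i + - j * r) (s * j + - j * s) w \<in> K" using comb by blast
    then have "x [^] D \<otimes> c [^] w \<in> K" by (simp add: nf_def D_def algebra_simps)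
    then have xK: "x \<in> K" using close by blast
    obtain w where "nf (- r * i + i * r) (- r * j + i * s) w \<in> K" using comb by blast
    then have "y [^] D \<otimes> c [^] w \<in> K" by (simp add: nf_def D_def algebra_simps)
    then have yK: "y \<in> K" using close by blast
    have "?H \<subseteq> K" using xK yK K(1) by (intro generate_subgroup_incl) auto
    then show False using K(2) by blast
  qed
  then show ?thesis using A1_group_subgroup_iff[OF p G sub] xH yH nc by blast
qed

end

section \<open>Presented groups\<close>

definition eval_word :: "('b, 'c) monoid_scheme \<Rightarrow> ('g \<Rightarrow> 'b) \<Rightarrow> 'g word \<Rightarrow> 'b" where
  "eval_word K f w =
     foldr (\<lambda>(x, e) r. (if e then f x else inv\<^bsub>K\<^esub> (f x)) \<otimes>\<^bsub>K\<^esub> r) w \<one>\<^bsub>K\<^esub>"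

lemma eval_word_Nil [simp]: "eval_word K f [] = \<one>\<^bsub>K\<^esub>"
  by (simp add: eval_word_def)

lemma eval_word_Cons [simp]:
  "eval_word K f ((x, e) # w) = (if e then f x else inv\<^bsub>K\<^esub> (f x)) \<otimes>\<^bsub>K\<^esub> eval_word K f w"
  by (simp add: eval_word_def)

context group
begin

lemma eval_word_closed [simp, intro]:
  assumes "\<And>x. f x \<in> carrier G"
  shows "eval_word G f w \<in> carrier G"
  using assms by (induction w) auto

lemma eval_word_append:
  assumes "\<And>x. f x \<in> carrier G"
  shows "eval_word G f (u @ v) = eval_word G f u \<otimes> eval_word G f v"
  using assms by (induction u) (auto simp: m_assoc)

lemma eval_word_replicate:
  assumes "\<And>x. f x \<in> carrier G"
  shows "eval_word G f (replicate k (x, True)) = f x [^] k"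
  using assms group_commutes_pow[of "f x" "f x", symmetric] by (induction k) auto

lemma eval_word_in_generate:
  shows "eval_word G f w \<in> generate G (range f)"
proof (induction w)
  case Nil
  show ?case by (simp add: generate.one)
next
  case (Cons l w)
  obtain x e where "l = (x, e)" by (cases l)
  moreover have "(if e then f x else inv (f x)) \<in> generate G (range f)"
    by (auto intro: generate.incl generate.inv)
  ultimately show ?case using Cons by (simp add: generate.eng)
qed

text \<open>Free cancellation holds in every group and the relations hold by assumption, so
  evaluation is constant on the classes of the congruence.\<close>

lemma eval_word_pres_eq:
  assumes f: "\<And>x. f x \<in> carrier G"
    and R: "\<And>u v. (u, v) \<in> R \<Longrightarrow> eval_word G f u = eval_word G f v"
    and "pres_eq R u v"
  shows "eval_word G f u = eval_word G f v"
  using assms(3)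
  by induction (auto simp: eval_word_append[OF f] R f)

end

abbreviation pres_gen :: "('g word \<times> 'g word) set \<Rightarrow> 'g \<Rightarrow> 'g word set" where
  "pres_gen R x \<equiv> pres_rel R `` {[(x, True)]}"

lemma carrier_presented_group: "carrier (presented_group R) = range (\<lambda>u. pres_rel R `` {u})"
  by (auto simp: presented_group_def quotient_def)

lemma one_presented_group: "\<one>\<^bsub>presented_group R\<^esub> = pres_rel R `` {[]}"
  by (simp add: presented_group_def)

lemma pres_class_closed [simp, intro]: "pres_rel R `` {u} \<in> carrier (presented_group R)"
  by (auto simp: carrier_presented_group)

lemma inv_pres_gen: "inv\<^bsub>presented_group R\<^esub> (pres_gen R x) = pres_rel R `` {[(x, False)]}"
  using pres_eq.cancel[of R x False]
  by (intro group.inv_equality[OF group_presented_group])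
     (simp_all add: one_presented_group mult_presented_group pres_class_eq_iff)

lemma pres_class_eq_eval_word:
  "pres_rel R `` {w} = eval_word (presented_group R) (pres_gen R) w"
proof (induction w)
  case Nil
  show ?case by (simp add: one_presented_group)
next
  case (Cons l w)
  obtain x e where l: "l = (x, e)" by (cases l)
  have "pres_rel R `` {l # w} = pres_rel R `` {[l]} \<otimes>\<^bsub>presented_group R\<^esub> pres_rel R `` {w}"
    by (simp add: mult_presented_group)
  then show ?case using Cons by (cases e) (simp_all add: l inv_pres_gen)
qed

lemma eval_word_presented_group_rel:
  assumes "(u, v) \<in> R"
  shows "eval_word (presented_group R) (pres_gen R) u = eval_word (presented_group R) (pres_gen R) v"
  using pres_eq.rel[OF assms] by (simp add: pres_class_eq_iff flip: pres_class_eq_eval_word)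

lemma generate_pres_gen: "generate (presented_group R) (range (pres_gen R)) = carrier (presented_group R)"
proof
  show "generate (presented_group R) (range (pres_gen R)) \<subseteq> carrier (presented_group R)"
    by (intro group.generate_incl group_presented_group) auto
  show "carrier (presented_group R) \<subseteq> generate (presented_group R) (range (pres_gen R))"
  proof
    fix A assume "A \<in> carrier (presented_group R)"
    then obtain u where "A = pres_rel R `` {u}" by (auto simp: carrier_presented_group)
    then show "A \<in> generate (presented_group R) (range (pres_gen R))"
      using group.eval_word_in_generate[OF group_presented_group, of R "pres_gen R" u]
      by (simp only: pres_class_eq_eval_word[of R u])
  qed
qed

text \<open>The universal property (von Dyck). The map evaluates a chosen representative of each
  class; the choice does not affect the value.\<close>

theorem presented_group_hom_exists:
  assumes K: "group K" and f: "\<And>x. f x \<in> carrier K"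
    and R: "\<And>u v. (u, v) \<in> R \<Longrightarrow> eval_word K f u = eval_word K f v"
  obtains h where "h \<in> hom (presented_group R) K" "\<And>x. h (pres_gen R x) = f x"
proof -
  interpret K: group K by (rule K)
  define h where "h A = eval_word K f (SOME w. w \<in> A)" for A
  have h: "h (pres_rel R `` {u}) = eval_word K f u" for u
  proof -
    have "u \<in> pres_rel R `` {u}" by (auto simp: pres_rel_def intro: pres_eq.refl)
    then have "(SOME w. w \<in> pres_rel R `` {u}) \<in> pres_rel R `` {u}" by (rule someI)
    then have "pres_eq R u (SOME w. w \<in> pres_rel R `` {u})" by (simp add: pres_rel_def)
    from K.eval_word_pres_eq[OF f R this] show ?thesis by (simp add: h_def)
  qed
  have "h \<in> hom (presented_group R) K"
    by (rule homI) (auto simp: carrier_presented_group h mult_presented_group K.eval_word_append f)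
  moreover have "h (pres_gen R x) = f x" for x using h f by simp
  ultimately show ?thesis using that by blast
qed

section \<open>The groups \<open>M_p(n,m,1)\<close>\<close>

definition M_rels :: "nat \<Rightarrow> nat \<Rightarrow> nat \<Rightarrow> (gen_abc word \<times> gen_abc word) set" where
  "M_rels p n m =
    {(replicate (p ^ n) (gen_a, True), []),
     (replicate (p ^ m) (gen_b, True), []),
     (replicate p (gen_c, True), []),
     ([(gen_a, False), (gen_b, False), (gen_a, True), (gen_b, True)], [(gen_c, True)]),
     ([(gen_c, False), (gen_a, False), (gen_c, True), (gen_a, True)], []),
     ([(gen_c, False), (gen_b, False), (gen_c, True), (gen_b, True)], [])}"

lemma M_pres_eq: "M_pres p n m = presented_group (M_rels p n m)"
  by (simp add: M_pres_def M_rels_def Let_def)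

text \<open>Once \<open>c\<close> is sent to \<open>0\<close>, the commutator relations hold in any
  abelian target, and only the orders of the images of \<open>a\<close> and \<open>b\<close> remain
  to be checked. Such maps serve to read off the exponents of \<open>a\<close> and
  \<open>b\<close>.\<close>

lemma M_pres_exponent_hom:
  assumes c: "f gen_c = 0" and f: "\<And>x. f x \<in> carrier (integer_mod_group N)"
    and a: "(int (p ^ n) * f gen_a) mod int N = 0" and b: "(int (p ^ m) * f gen_b) mod int N = 0"
  shows "\<exists>h \<in> hom (M_pres p n m) (integer_mod_group N).
    \<forall>x. h (pres_gen (M_rels p n m) x) = f x"
proof (rule presented_group_hom_exists[of "integer_mod_group N" f "M_rels p n m"])
  let ?Z = "integer_mod_group N"
  interpret Z: comm_group ?Z by simp
  have comm: "inv\<^bsub>?Z\<^esub> x \<otimes>\<^bsub>?Z\<^esub> (inv\<^bsub>?Z\<^esub> y \<otimes>\<^bsub>?Z\<^esub> (x \<otimes>\<^bsub>?Z\<^esub> (y \<otimes>\<^bsub>?Z\<^esub> \<one>\<^bsub>?Z\<^esub>))) = \<one>\<^bsub>?Z\<^esub>"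
    if "x \<in> carrier ?Z" "y \<in> carrier ?Z" for x y
  proof -
    have "inv\<^bsub>?Z\<^esub> x \<otimes>\<^bsub>?Z\<^esub> (inv\<^bsub>?Z\<^esub> y \<otimes>\<^bsub>?Z\<^esub> (x \<otimes>\<^bsub>?Z\<^esub> y)) = inv\<^bsub>?Z\<^esub> (y \<otimes>\<^bsub>?Z\<^esub> x) \<otimes>\<^bsub>?Z\<^esub> (x \<otimes>\<^bsub>?Z\<^esub> y)"
      using that by (simp only: Z.inv_mult_group Z.m_assoc Z.inv_closed Z.m_closed)
    also have "\<dots> = \<one>\<^bsub>?Z\<^esub>" using that by (simp only: Z.m_comm[of x y] Z.l_inv Z.m_closed)
    finally show ?thesis using that by (simp only: Z.r_one)
  qed
  have 1: "eval_word ?Z f (replicate (p ^ n) (gen_a, True)) = eval_word ?Z f []"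
    using a by (simp add: Z.eval_word_replicate[OF f])
  have 2: "eval_word ?Z f (replicate (p ^ m) (gen_b, True)) = eval_word ?Z f []"
    using b by (simp add: Z.eval_word_replicate[OF f])
  have 3: "eval_word ?Z f (replicate p (gen_c, True)) = eval_word ?Z f []"
    by (simp add: Z.eval_word_replicate[OF f] c)
  have 4: "eval_word ?Z f [(x, False), (y, False), (x, True), (y, True)] = eval_word ?Z f []" for x y
    using comm[OF f f] by (simp only: eval_word_Cons eval_word_Nil if_True if_False)
  have 5: "eval_word ?Z f [(gen_c, True)] = eval_word ?Z f []"
    by (simp add: c)
  show "eval_word ?Z f u = eval_word ?Z f v" if "(u, v) \<in> M_rels p n m" for u v
    using that unfolding M_rels_def insert_iff prod.inject empty_iff
    by (elim disjE conjE) (simp_all only: 1 2 3 4 5)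
next
  show "group (integer_mod_group N)" by simp
  show "f x \<in> carrier (integer_mod_group N)" for x by (rule f)
  show ?thesis if "h \<in> hom (presented_group (M_rels p n m)) (integer_mod_group N)"
    "\<And>x. h (pres_gen (M_rels p n m) x) = f x" for h
    using that by (auto simp only: M_pres_eq)
qed

text \<open>Everything that is needed from the presentation. The last clause is independence of
  \<open>A\<close> and \<open>B\<close> modulo their commutator; it is proved by mapping to cyclic
  groups of order \<open>p^n\<close> and \<open>p^m\<close>, in which one generator goes to
  \<open>1\<close> and the others to \<open>0\<close>.\<close>

lemma M_pres_generators:
  obtains A B where
    "A \<in> carrier (M_pres p n m)" "B \<in> carrier (M_pres p n m)"
    "generate (M_pres p n m) {A, B} = carrier (M_pres p n m)"
    "A [^]\<^bsub>M_pres p n m\<^esub> (p ^ n) = \<one>\<^bsub>M_pres p n m\<^esub>"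
    "B [^]\<^bsub>M_pres p n m\<^esub> (p ^ m) = \<one>\<^bsub>M_pres p n m\<^esub>"
    "\<And>i j k :: int. A [^]\<^bsub>M_pres p n m\<^esub> i \<otimes>\<^bsub>M_pres p n m\<^esub> B [^]\<^bsub>M_pres p n m\<^esub> j
        \<otimes>\<^bsub>M_pres p n m\<^esub> commutator (M_pres p n m) A B [^]\<^bsub>M_pres p n m\<^esub> k = \<one>\<^bsub>M_pres p n m\<^esub>
      \<Longrightarrow> int (p ^ n) dvd i \<and> int (p ^ m) dvd j"
proof -
  let ?R = "M_rels p n m"
  define Q where "Q = M_pres p n m"
  have Q: "Q = presented_group ?R" by (simp add: Q_def M_pres_eq)
  interpret Q: group Q unfolding Q by (rule group_presented_group)
  define A where "A = pres_gen ?R gen_a"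
  define B where "B = pres_gen ?R gen_b"
  define C where "C = pres_gen ?R gen_c"
  have cl: "pres_gen ?R x \<in> carrier Q" for x by (simp add: Q)
  then have [simp]: "A \<in> carrier Q" "B \<in> carrier Q" "C \<in> carrier Q"
    by (simp_all add: A_def B_def C_def)
  have rel: "eval_word Q (pres_gen ?R) u = eval_word Q (pres_gen ?R) v" if "(u, v) \<in> ?R" for u v
    using eval_word_presented_group_rel[OF that] by (simp add: Q)
  have An: "A [^]\<^bsub>Q\<^esub> (p ^ n) = \<one>\<^bsub>Q\<^esub>"
  proof -
    have "(replicate (p ^ n) (gen_a, True), []) \<in> ?R" by (simp add: M_rels_def)
    from rel[OF this] show ?thesis by (simp add: Q.eval_word_replicate cl A_def)
  qed
  have Bm: "B [^]\<^bsub>Q\<^esub> (p ^ m) = \<one>\<^bsub>Q\<^esub>"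
  proof -
    have "(replicate (p ^ m) (gen_b, True), []) \<in> ?R" by (simp add: M_rels_def)
    from rel[OF this] show ?thesis by (simp add: Q.eval_word_replicate cl B_def)
  qed
  have C: "commutator Q A B = C"
  proof -
    have "([(gen_a, False), (gen_b, False), (gen_a, True), (gen_b, True)], [(gen_c, True)]) \<in> ?R"
      by (simp add: M_rels_def)
    from rel[OF this] show ?thesis
      by (simp add: commutator_def Q.m_assoc cl A_def B_def C_def)
  qed
  have sub: "subgroup (generate Q {A, B}) Q" by (rule Q.generate_is_subgroup) auto
  have AB: "A \<in> generate Q {A, B}" "B \<in> generate Q {A, B}" by (auto intro: generate.incl)
  then have "C \<in> generate Q {A, B}"
    unfolding C[symmetric] commutator_def
    by (intro subgroup.m_closed[OF sub] subgroup.m_inv_closed[OF sub])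
  then have "pres_gen ?R x \<in> generate Q {A, B}" for x
    using AB by (cases x) (simp_all add: A_def B_def C_def)
  then have "generate Q (range (pres_gen ?R)) \<subseteq> generate Q {A, B}"
    by (intro Q.generate_subgroup_incl sub) auto
  then have gen: "generate Q {A, B} = carrier Q"
    using generate_pres_gen[of ?R] subgroup.subset[OF sub] by (simp add: Q)
  have dvd: "int (p ^ n) dvd i \<and> int (p ^ m) dvd j"
    if eq: "A [^]\<^bsub>Q\<^esub> i \<otimes>\<^bsub>Q\<^esub> B [^]\<^bsub>Q\<^esub> j \<otimes>\<^bsub>Q\<^esub> commutator Q A B [^]\<^bsub>Q\<^esub> k = \<one>\<^bsub>Q\<^esub>"
    for i j k :: int
  proof -
    have *: "(i * f gen_a + j * f gen_b) mod int N = 0"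
      if c: "f gen_c = 0" and f: "\<And>x. f x \<in> carrier (integer_mod_group N)"
        and a: "(int (p ^ n) * f gen_a) mod int N = 0"
        and b: "(int (p ^ m) * f gen_b) mod int N = 0" for f N
    proof -
      obtain h where h: "h \<in> hom Q (integer_mod_group N)" and hf: "\<And>x. h (pres_gen ?R x) = f x"
        using M_pres_exponent_hom[OF c f a b] unfolding Q_def by blast
      interpret h: group_hom Q "integer_mod_group N" h
        by (intro group_hom.intro group_hom_axioms.intro h Q.group_axioms) simp
      have "h (A [^]\<^bsub>Q\<^esub> i \<otimes>\<^bsub>Q\<^esub> B [^]\<^bsub>Q\<^esub> j \<otimes>\<^bsub>Q\<^esub> C [^]\<^bsub>Q\<^esub> k) = 0"
        using arg_cong[OF eq, of h] unfolding C h.hom_one by simp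
      then have "((i * f gen_a) mod int N + (j * f gen_b) mod int N) mod int N = 0"
        by (simp add: h.hom_int_pow int_pow_integer_mod_group hf c A_def B_def C_def cl mod_simps)
      then show ?thesis by (simp add: mod_simps)
    qed
    \<comment> \<open>The reduced form \<open>1 mod int N\<close> also lies in the carrier when
      \<open>N = 1\<close>.\<close>
    have 1: "1 mod int N \<in> carrier (integer_mod_group N)" for N
      by (simp add: carrier_integer_mod_group)
    have "(i * (1 mod int (p ^ n))) mod int (p ^ n) = 0"
      using *[of "\<lambda>x. if x = gen_a then 1 mod int (p ^ n) else 0" "p ^ n"] 1[of "p ^ n"] by simp
    moreover have "(j * (1 mod int (p ^ m))) mod int (p ^ m) = 0"
      using *[of "\<lambda>x. if x = gen_b then 1 mod int (p ^ m) else 0" "p ^ m"] 1[of "p ^ m"] by simp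
    ultimately show ?thesis by (simp add: mod_simps dvd_eq_mod_eq_0)
  qed
  show ?thesis
    using that[of A B] gen An Bm dvd unfolding Q_def[symmetric] by simp
qed

section \<open>Finite p-groups\<close>

lemma (in group) cyclic_of_iso_integer_mod_group:
  assumes p: "Factorial_Ring.prime p" and N: "subgroup N G"
    and iso: "G\<lparr>carrier := N\<rparr> \<cong> integer_mod_group p"
  obtains d where "d \<in> N" "d \<in> carrier G" "N = {d [^] (i::int) | i. True}"
    "\<And>i::int. d [^] i = \<one> \<longleftrightarrow> int p dvd i"
proof -
  obtain h where h: "h \<in> iso (G\<lparr>carrier := N\<rparr>) (integer_mod_group p)"
    using iso unfolding is_iso_def by blast
  have hom: "h \<in> hom (G\<lparr>carrier := N\<rparr>) (integer_mod_group p)" and bij: "bij_betw h N {0..<int p}"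
    using h prime_gt_0_nat[OF p] by (auto simp: iso_def carrier_integer_mod_group)
  have "1 \<in> {0..<int p}" using prime_gt_1_nat[OF p] by simp
  then obtain d where d: "d \<in> N" "h d = 1" using bij unfolding bij_betw_def by (metis imageE)
  have dG: "d \<in> carrier G" using d(1) subgroup.subset[OF N] by blast
  have hd: "h (d [^] i) = i mod int p" for i :: int
  proof -
    have "h (d [^]\<^bsub>G\<lparr>carrier := N\<rparr>\<^esub> i) = h d [^]\<^bsub>integer_mod_group p\<^esub> i"
      using d(1) by (intro hom_int_pow hom subgroup_imp_group N) simp_all
    then show ?thesis
      using int_pow_consistent[OF N d(1), of i] d(2) by (simp add: int_pow_integer_mod_group)
  qed
  have mem: "d [^] i \<in> N" for i :: int by (rule subgroup_int_pow_closed[OF N d(1)])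
  have eq: "u = v" if "u \<in> N" "v \<in> N" "h u = h v" for u v
    using that bij unfolding bij_betw_def by (meson inj_onD)
  have "z \<in> {d [^] (i::int) | i. True}" if "z \<in> N" for z
  proof -
    have "h z \<in> {0..<int p}" using that bij unfolding bij_betw_def by blast
    then have "h z = h (d [^] (h z))" by (simp add: hd)
    then show ?thesis using eq[OF that mem] by blast
  qed
  then have N_eq: "N = {d [^] (i::int) | i. True}" using mem by blast
  have ord: "d [^] i = \<one> \<longleftrightarrow> int p dvd i" for i :: int
  proof -
    have "d [^] i = \<one> \<longleftrightarrow> h (d [^] i) = h (d [^] (0::int))"
      using eq[OF mem mem, of i 0] by auto
    then show ?thesis by (simp only: hd) (simp add: dvd_eq_mod_eq_0)
  qed
  show ?thesis by (rule that[OF d(1) dG N_eq ord])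
qed

text \<open>Conjugation by \<open>g\<close> raises a generator of \<open>N\<close> to some power \<open>k\<close>. As \<open>g\<close> has order a power
  of \<open>p\<close>, some \<open>k\<^bsup>p^e\<^esup>\<close> is 1 modulo \<open>p\<close>, hence so is \<open>k\<close> by Fermat.\<close>

lemma (in group) normal_prime_order_central:
  assumes p: "Factorial_Ring.prime p" and G: "finite_p_group p G" and N: "N \<lhd> G"
    and iso: "G\<lparr>carrier := N\<rparr> \<cong> integer_mod_group p"
    and z: "z \<in> N" and g: "g \<in> carrier G"
  shows "z \<otimes> g = g \<otimes> z"
proof -
  obtain d where d: "d \<in> N" "d \<in> carrier G" and N_eq: "N = {d [^] (i::int) | i. True}"
    and ord: "\<And>i::int. d [^] i = \<one> \<longleftrightarrow> int p dvd i"
    using cyclic_of_iso_integer_mod_group[OF p normal_imp_subgroup[OF N] iso] by blast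
  have eq_iff: "d [^] i = d [^] j \<longleftrightarrow> int p dvd i - j" for i j :: int
    using d(2) ord[of "i - j"] by (simp add: int_pow_diff inv_solve_right')
  have p0: "int p > 0" using prime_gt_0_nat[OF p] by simp
  obtain i0 :: int where i0: "g \<otimes> d \<otimes> inv g = d [^] i0"
    using normal.inv_op_closed2[OF N g d(1)] N_eq by blast
  define k where "k = nat (i0 mod int p)"
  have "int k = i0 mod int p" using p0 by (simp add: k_def)
  then have k: "g \<otimes> d \<otimes> inv g = d [^] int k"
    using i0 eq_iff[of i0 "int k"] by (simp add: minus_mod_eq_mult_div)
  have iter: "g [^] j \<otimes> d \<otimes> inv (g [^] j) = d [^] (int (k ^ j))" for j :: nat
  proof (induction j)
    case 0
    show ?case using d by simp
  next
    case (Suc j)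
    have "g [^] Suc j \<otimes> d \<otimes> inv (g [^] Suc j) = g [^] j \<otimes> (g \<otimes> d \<otimes> inv g) \<otimes> inv (g [^] j)"
      using g d by (simp add: inv_mult_group m_assoc)
    also have "\<dots> = (g [^] j \<otimes> d \<otimes> inv (g [^] j)) [^] int k"
      using conj_int_pow[of "g [^] j" d "int k"] g d by (simp add: k)
    also have "\<dots> = d [^] (int (k ^ Suc j))"
      using d by (simp add: Suc int_pow_pow mult.commute)
    finally show ?case .
  qed
  obtain e where e: "order G = p ^ e" using finite_p_groupD(3)[OF G] by blast
  have "d [^] (int (k ^ (p ^ e))) = d [^] (1::int)"
    using iter[of "p ^ e"] pow_order_eq_1[OF g] d by (simp add: e)
  then have "int p dvd int (k ^ (p ^ e)) - 1" using eq_iff by blast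
  then have 1: "[k ^ (p ^ e) = 1] (mod p)"
    by (metis cong_iff_dvd_diff cong_int_iff of_nat_1)
  have "\<not> p dvd k"
  proof
    assume "p dvd k"
    then have "p dvd k ^ (p ^ e)" 
      using prime_gt_0_nat[OF p] by (intro dvd_trans[OF _ dvd_power]) auto
    then have "p dvd 1" using cong_dvd_iff[OF 1] by blast
    then show False using prime_gt_1_nat[OF p] by simp
  qed
  then have "[k ^ (p - 1) * k = 1 * k] (mod p)"
    using fermat_theorem[OF p] cong_scalar_right by blast
  then have fermat: "[k ^ p = k] (mod p)"
    using prime_gt_0_nat[OF p] by (metis mult_1 power_minus_mult)
  have "[k ^ (p ^ j) = k] (mod p)" for j
  proof (induction j)
    case (Suc j)
    have "[(k ^ (p ^ j)) ^ p = k ^ p] (mod p)" using Suc by (rule cong_pow)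
    then show ?case using fermat by (simp add: power_mult mult.commute) (metis cong_trans power_mult mult.commute)
  qed simp
  then have "[k = 1] (mod p)" using 1 cong_sym cong_trans by blast
  then have "int p dvd int k - 1" by (metis cong_iff_dvd_diff cong_int_iff of_nat_1)
  then have "d [^] int k = d" using eq_iff[of "int k" 1] d by simp
  then have "g \<otimes> d = d \<otimes> g" using k g d by (simp add: inv_solve_right')
  moreover obtain i :: int where "z = d [^] i" using z N_eq by blast
  ultimately show ?thesis using int_pow_commute[of d g i 1] g d by simp
qed

section \<open>The Frattini subgroup of an abelian p-group\<close>

text \<open>If a maximal subgroup \<open>M\<close> misses \<open>g^p\<close>, then \<open>M\<close>
  and \<open>g^p\<close> generate the group, so \<open>g\<close> is an element of \<open>M\<close>
  times \<open>g^(pi)\<close>. Hence \<open>g^(1 - pi)\<close> is in \<open>M\<close>, and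
  \<open>1 - pi\<close> is prime to \<open>p\<close>, which forces \<open>g\<close> into
  \<open>M\<close>.\<close>

lemma (in comm_group) pow_in_frattini:
  assumes p: "Factorial_Ring.prime p" and G: "finite_p_group p G" and g: "g \<in> carrier G"
  shows "g [^] p \<in> frattini G"
proof -
  have "g [^] p \<in> M" if M: "maximal_subgroup M G" for M
  proof (rule ccontr)
    assume notin: "g [^] p \<notin> M"
    have subM: "subgroup M G" using M by (simp add: maximal_subgroup_def)
    let ?C = "generate G {g [^] p}"
    have subC: "subgroup ?C G" using g by (intro generate_is_subgroup) auto
    have subK: "subgroup (M <#> ?C) G" by (rule mult_subgroups[OF subM subC])
    have "M \<subseteq> M <#> ?C"
    proof
      fix m assume "m \<in> M"
      then show "m \<in> M <#> ?C"
        using subgroup.one_closed[OF subC] subgroup.mem_carrier[OF subM]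
        unfolding set_mult_def by force
    qed
    moreover have "g [^] p \<in> M <#> ?C"
    proof -
      have "\<one> \<otimes> g [^] p \<in> M <#> ?C"
        using subgroup.one_closed[OF subM] generate.incl[of "g [^] p" "{g [^] p}" G]
        unfolding set_mult_def by blast
      then show ?thesis using g by simp
    qed
    ultimately have "M <#> ?C = carrier G"
      using M notin subK unfolding maximal_subgroup_def by metis
    then obtain m t where mt: "m \<in> M" "t \<in> ?C" "g = m \<otimes> t"
      using g unfolding set_mult_def by blast
    then obtain i :: int where "t = (g [^] p) [^] i"
      using generate_pow[of "g [^] p"] g by auto
    then have t: "t = g [^] (int p * i)"
      using int_pow_pow[OF g, of "int p" i] by (simp add: int_pow_int)
    have "g [^] (1 - int p * i) = m"
      using mt(3) g subgroup.mem_carrier[OF subM mt(1)] unfolding t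
      by (subst int_pow_diff) (simp_all add: inv_solve_right')
    then have 1: "g [^] (1 - int p * i) \<in> M" using mt by simp
    obtain e where e: "order G = p ^ e" using finite_p_groupD(3)[OF G] by blast
    have 2: "g [^] int (p ^ e) \<in> M"
      unfolding int_pow_int using pow_order_eq_1[OF g] e subgroup.one_closed[OF subM] by simp
    have "coprime (1 - int p * i) (int p)"
    proof (rule coprimeI)
      fix r assume "r dvd 1 - int p * i" "r dvd int p"
      then show "is_unit r" by (metis diff_add_cancel dvd_add_right_iff dvd_mult2)
    qed
    then have "g \<in> M" using int_pow_coprime_mem[OF subM g 1 2] by simp
    then have "g [^] p \<in> M" using subgroup_int_pow_closed[OF subM, of g "int p"] by (simp add: int_pow_int)
    with notin show False by blast
  qed
  then show ?thesis using g by (simp add: frattini_def)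
qed

section \<open>Subgroups of prime index\<close>

text \<open>The index of \<open>H\<close> is the index of \<open>K\<close> times \<open>q\<close>,
  the index of \<open>H\<close> in \<open>K\<close>; as it is prime, one of the factors is
  1.\<close>

lemma (in group) prime_index_maximal:
  assumes fin: "finite (carrier G)" and H: "subgroup H G"
    and p: "Factorial_Ring.prime (card (rcosets H))"
    and K: "subgroup K G" "H \<subseteq> K"
  shows "K = H \<or> K = carrier G"
proof -
  have finK: "finite K" using fin subgroup.subset[OF K(1)] finite_subset by blast
  have "subgroup H (G\<lparr>carrier := K\<rparr>)" by (rule subgroup_incl[OF H K])
  from group.lagrange[OF subgroup_imp_group[OF K(1)] this]
  have "card H dvd card K" by (simp add: order_def dvd_def) (metis mult.commute)
  then obtain q where q: "card K = q * card H" by (metis dvd_def mult.commute)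
  have H0: "card H > 0" using subgroup.finite_imp_card_positive[OF H fin] .
  have "card (rcosets K) * q * card H = card (rcosets H) * card H"
    using lagrange[OF H] lagrange[OF K(1)] by (simp add: q)
  then have "card (rcosets K) * q = card (rcosets H)" using H0 by simp
  then have "q = 1 \<or> card (rcosets K) = 1" using p by (metis prime_product)
  then show ?thesis
  proof
    assume "q = 1"
    then show ?thesis using q card_subset_eq[OF finK K(2)] by simp
  next
    assume "card (rcosets K) = 1"
    then show ?thesis using index_one_iff[OF fin K(1)] by simp
  qed
qed

text \<open>By maximality \<open>G = NH\<close>. Since \<open>[N,G]\<close> lies in
  \<open>H\<close>, the subgroup \<open>N\<close> normalises \<open>H\<close>, so \<open>H\<close>
  is normal, and \<open>G/H\<close> is an image of \<open>N\<close> in which commutators vanish.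
  This is used to climb along a central series, first with \<open>G3 G\<close> and then with the
  derived subgroup.\<close>

lemma (in group) prime_index_derived_subset:
  assumes fin: "finite (carrier G)" and H: "subgroup H G"
    and p: "Factorial_Ring.prime (card (rcosets H))"
    and N: "N \<lhd> G" and NH: "\<not> N \<subseteq> H"
    and comm: "\<And>z g. z \<in> N \<Longrightarrow> g \<in> carrier G \<Longrightarrow> commutator G z g \<in> H"
  shows "derived G (carrier G) \<subseteq> H"
proof -
  have subN: "subgroup N G" by (rule normal_imp_subgroup[OF N])
  have HG: "h \<in> carrier G" if "h \<in> H" for h using that subgroup.mem_carrier[OF H] by blast
  have NG: "h \<in> carrier G" if "h \<in> N" for h using that subgroup.mem_carrier[OF subN] by blast
  have sub: "subgroup (N <#> H) G" by (rule mult_norm_subgroup[OF N H])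
  have "H \<subseteq> N <#> H"
    using subgroup.one_closed[OF subN] HG unfolding set_mult_def by force
  moreover have "N \<subseteq> N <#> H"
    using subgroup.one_closed[OF H] NG unfolding set_mult_def by force
  ultimately have NH_eq: "N <#> H = carrier G"
    using prime_index_maximal[OF fin H p sub] NH by blast
  have conj_N: "z \<otimes> h \<otimes> inv z \<in> H" if z: "z \<in> N" and h: "h \<in> H" for z h
  proof -
    have "z \<otimes> h \<otimes> inv z = commutator G (inv z) (inv h) \<otimes> h"
      using z h HG NG by (simp add: commutator_def m_assoc)
    moreover have "commutator G (inv z) (inv h) \<in> H"
      using z h HG subgroup.m_inv_closed[OF subN] by (intro comm) auto
    ultimately show ?thesis using h subgroup.m_closed[OF H] by simp
  qed
  have "g \<otimes> h \<otimes> inv g \<in> H" if g: "g \<in> carrier G" and h: "h \<in> H" for g h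
  proof -
    obtain z w where zw: "z \<in> N" "w \<in> H" "g = z \<otimes> w"
      using g NH_eq unfolding set_mult_def by blast
    have "g \<otimes> h \<otimes> inv g = z \<otimes> (w \<otimes> h \<otimes> inv w) \<otimes> inv z"
      using zw h HG NG by (simp add: m_assoc inv_mult_group)
    moreover have "w \<otimes> h \<otimes> inv w \<in> H"
      using zw h subgroup.m_closed[OF H] subgroup.m_inv_closed[OF H] by simp
    ultimately show ?thesis using conj_N zw by simp
  qed
  then have nH: "H \<lhd> G" using H normal_inv_iff by blast
  interpret nH: normal H G by (rule nH)
  \<comment> \<open>Every coset of \<open>H\<close> has a representative in \<open>N\<close>, so
    commutativity of the quotient need only be checked on \<open>N\<close>.\<close>
  have cos: "\<exists>z\<in>N. U = H #> z" if "U \<in> carrier (G Mod H)" for U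
  proof -
    obtain g where g: "g \<in> carrier G" "U = H #> g" using \<open>U \<in> _\<close> by (auto simp: carrier_FactGroup)
    obtain z w where zw: "z \<in> N" "w \<in> H" "g = z \<otimes> w"
      using g NH_eq unfolding set_mult_def by blast
    have "g = (z \<otimes> w \<otimes> inv z) \<otimes> z" using zw HG NG by (simp add: m_assoc)
    then have "g \<in> H #> z" using conj_N[OF zw(1,2)] unfolding r_coset_def by auto
    then show ?thesis using g repr_independence[OF _ NG[OF zw(1)] H] zw(1) by blast
  qed
  have "comm_group (G Mod H)"
  proof (rule group.group_comm_groupI[OF nH.factorgroup_is_group])
    fix U W assume "U \<in> carrier (G Mod H)" "W \<in> carrier (G Mod H)"
    then obtain z w where zw: "z \<in> N" "w \<in> N" "U = H #> z" "W = H #> w" using cos by metis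
    have zwG: "z \<in> carrier G" "w \<in> carrier G" using zw NG by auto
    have "inv w \<otimes> (w \<otimes> z) = z" using zwG by (simp flip: m_assoc)
    then have "z \<otimes> w = commutator G (inv z) (inv w) \<otimes> (w \<otimes> z)"
      using zwG by (simp add: commutator_def m_assoc)
    moreover have "commutator G (inv z) (inv w) \<in> H"
      using zw zwG subgroup.m_inv_closed[OF subN] by (intro comm) auto
    ultimately have "z \<otimes> w \<in> H #> (w \<otimes> z)" unfolding r_coset_def by auto
    then have "H #> (w \<otimes> z) = H #> (z \<otimes> w)"
      using zwG by (intro repr_independence H) auto
    then show "U \<otimes>\<^bsub>G Mod H\<^esub> W = W \<otimes>\<^bsub>G Mod H\<^esub> U"
      using zw zwG by (simp add: nH.rcos_sum)
  qed
  then show ?thesis by (rule derived_minimal[OF nH])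
qed

text \<open>A subgroup containing the derived subgroup is normal, and the order of the quotient
  kills every coset.\<close>

lemma (in group) pow_index_mem:
  assumes H: "subgroup H G" and D: "derived G (carrier G) \<subseteq> H"
    and g: "g \<in> carrier G"
  shows "g [^] card (rcosets H) \<in> H"
proof -
  have "a \<otimes> h \<otimes> inv a \<in> H" if "a \<in> carrier G" "h \<in> H" for a h
  proof -
    have hG: "h \<in> carrier G" using that subgroup.mem_carrier[OF H] by blast
    have "a \<otimes> h \<otimes> inv a \<otimes> inv h \<in> derived G (carrier G)"
      using that hG unfolding derived_def by (intro generate.incl) auto
    then have "a \<otimes> h \<otimes> inv a \<otimes> inv h \<otimes> h \<in> H"
      using D that(2) subgroup.m_closed[OF H] by blast
    then show ?thesis using that(1) hG by (simp add: m_assoc)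
  qed
  then have nH: "H \<lhd> G" using H normal_inv_iff by blast
  interpret nH: normal H G by (rule nH)
  interpret FG: group "G Mod H" by (rule nH.factorgroup_is_group)
  have "(H #> g) [^]\<^bsub>G Mod H\<^esub> card (rcosets H) = H"
    using FG.pow_order_eq_1[of "H #> g"] g by (simp add: order_def FactGroup_def RCOSETS_def) blast
  then have "H #> (g [^] card (rcosets H)) = H" using nH.FactGroup_pow[OF g] by simp
  then show ?thesis using g H by (metis nat_pow_closed rcos_self)
qed

section \<open>Counting cosets and elements of order dividing p\<close>

lemma (in group) card_rcosets_le:
  assumes H: "subgroup H G" and "finite S" and "S \<subseteq> carrier G"
    and cover: "\<And>g. g \<in> carrier G \<Longrightarrow> \<exists>h\<in>H. \<exists>s\<in>S. g = h \<otimes> s"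
  shows "card (rcosets H) \<le> card S"
proof -
  have "rcosets H \<subseteq> (\<lambda>s. H #> s) ` S"
  proof
    fix U assume "U \<in> rcosets H"
    then obtain g where g: "g \<in> carrier G" "U = H #> g" by (auto simp: RCOSETS_def)
    then obtain h s where hs: "h \<in> H" "s \<in> S" "g = h \<otimes> s" using cover by blast
    then have "g \<in> H #> s" unfolding r_coset_def by auto
    then show "U \<in> (\<lambda>s. H #> s) ` S" using g hs repr_independence[OF _ _ H] assms(3) by blast
  qed
  then show ?thesis using assms(2) by (meson card_image_le card_mono finite_imageI le_trans)
qed

text \<open>The \<open>p\<close>-th power map is an endomorphism with kernel \<open>?T\<close> and
  image \<open>?I\<close>, so the order of the group is the product of their sizes. The group is
  also covered by the translates of \<open>?I\<close> by \<open>u^i v^j\<close> with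
  \<open>i, j < p\<close>, hence has at most \<open>p^2\<close> times as many elements as
  \<open>?I\<close>.\<close>

lemma (in comm_group) card_torsion_two_generated:
  assumes fin: "finite (carrier G)" and uv: "u \<in> carrier G" "v \<in> carrier G"
    and gen: "generate G {u, v} = carrier G" and p: "p > 0"
  shows "card {g \<in> carrier G. g [^] p = \<one>} \<le> p * p"
proof -
  let ?f = "\<lambda>g. g [^] (p::nat)"
  let ?I = "?f ` carrier G"
  let ?T = "{g \<in> carrier G. g [^] p = \<one>}"
  have "?f \<in> hom G G" by (rule homI) (auto simp: nat_pow_distrib)
  then interpret f: group_hom G G ?f by unfold_locales
  have finI: "finite ?I" using fin by simp
  \<comment> \<open>Each fibre is a translate of the kernel \<open>?T\<close>.\<close>
  have fiber: "card {g \<in> carrier G. ?f g = w} = card ?T" if w: "w \<in> ?I" for w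
  proof -
    obtain g0 where g0: "g0 \<in> carrier G" "w = ?f g0" using w by blast
    have "{g \<in> carrier G. ?f g = w} = (\<lambda>t. g0 \<otimes> t) ` ?T"
    proof (intro equalityI subsetI)
      fix g assume g: "g \<in> {g \<in> carrier G. ?f g = w}"
      then have "g = g0 \<otimes> (inv g0 \<otimes> g)" "inv g0 \<otimes> g \<in> ?T"
        using g0 by (auto simp: nat_pow_distrib nat_pow_inv simp flip: m_assoc)
      then show "g \<in> (\<lambda>t. g0 \<otimes> t) ` ?T" by blast
    qed (use g0 in \<open>auto simp: nat_pow_distrib\<close>)
    moreover have "inj_on (\<lambda>t. g0 \<otimes> t) ?T" using g0 by (auto simp: inj_on_def)
    ultimately show ?thesis by (simp add: card_image)
  qed
  have "card (carrier G) = card (\<Union>w\<in>?I. {g \<in> carrier G. ?f g = w})"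
    by (rule arg_cong[of _ _ card]) auto
  also have "\<dots> = (\<Sum>w\<in>?I. card {g \<in> carrier G. ?f g = w})"
    using fin by (intro card_UN_disjoint) auto
  also have "\<dots> = card ?I * card ?T" using fiber by simp
  finally have 1: "card (carrier G) = card ?I * card ?T" .
  \<comment> \<open>A commuting pair is a class two pair with trivial commutator, so its normal
    forms are \<open>u^i v^j\<close>.\<close>
  interpret uv: class2_pair G u v \<one>
    using uv by unfold_locales (auto simp: m_comm)
  have "carrier G \<subseteq> (\<lambda>(i, j, w). u [^] i \<otimes> v [^] j \<otimes> w) ` ({..<p} \<times> {..<p} \<times> ?I)"
  proof
    fix g assume "g \<in> carrier G"
    then obtain i j k where "g = uv.nf i j k" using gen unfolding uv.generate_eq_nf by blast
    then have g: "g = u [^] i \<otimes> v [^] j" using uv by (simp add: uv.nf_def)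
    have split: "x [^] i = x [^] nat (i mod int p) \<otimes> ?f (x [^] (i div int p))"
      if "x \<in> carrier G" for x and i :: int
    proof -
      have "x [^] i = x [^] (i mod int p + (i div int p) * int p)" by simp
      also have "\<dots> = x [^] (i mod int p) \<otimes> (x [^] (i div int p)) [^] int p"
        using that by (simp only: int_pow_mult int_pow_pow)
      finally show ?thesis using p by (simp add: pow_nat int_pow_int)
    qed
    let ?a = "nat (i mod int p)" and ?b = "nat (j mod int p)"
    let ?w = "u [^] (i div int p) \<otimes> v [^] (j div int p)"
    have "g = u [^] ?a \<otimes> v [^] ?b \<otimes> ?f ?w"
      unfolding g split[OF uv(1), of i] split[OF uv(2), of j]
      using uv by (simp add: nat_pow_distrib m_ac)
    then have "g = (\<lambda>(i, j, w). u [^] i \<otimes> v [^] j \<otimes> w) (?a, ?b, ?f ?w)"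
      by (simp only: case_prod_conv)
    moreover have "?a \<in> {..<p}" "?b \<in> {..<p}"
      using p by (simp_all add: nat_less_iff)
    moreover have "?f ?w \<in> ?I"
      using uv by (intro imageI) simp
    ultimately show "g \<in> (\<lambda>(i, j, w). u [^] i \<otimes> v [^] j \<otimes> w) ` ({..<p} \<times> {..<p} \<times> ?I)"
      by (intro image_eqI[where x = "(?a, ?b, ?f ?w)"] SigmaI)
  qed
  then have "card (carrier G) \<le> card ({..<p} \<times> {..<p} \<times> ?I)"
    using finI by (intro surj_card_le) auto
  then have "card ?I * card ?T \<le> card ?I * (p * p)"
    using 1 by (simp add: card_cartesian_product mult.commute mult.left_commute)
  moreover have "card ?I > 0" using finI one_closed by (auto simp: card_gt_0_iff)
  ultimately show ?thesis by simp
qed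

section \<open>Groups with \<open>G\<^sub>3\<close> of prime order\<close>

lemma (in group) inv_commutator:
  assumes "x \<in> carrier G" "y \<in> carrier G"
  shows "inv (commutator G x y) = commutator G y x"
  using assms by (simp add: commutator_def inv_mult_group m_assoc)

lemma (in group) commutator_in_derived:
  assumes "x \<in> carrier G" "y \<in> carrier G"
  shows "commutator G x y \<in> derived G (carrier G)"
proof -
  have "commutator G x y = inv x \<otimes> inv y \<otimes> inv (inv x) \<otimes> inv (inv y)"
    using assms by (simp add: commutator_def)
  then show ?thesis
    using assms unfolding derived_def
    by (intro generate.incl UN_I[of "inv x"] UN_I[of "inv y"]) simp_all
qed

lemma (in group) commutator_in_G3:
  assumes "h \<in> derived G (carrier G)" "g \<in> carrier G"
  shows "commutator G h g \<in> G3 G"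
  using assms unfolding G3_def commutator_subgroup_def by (blast intro: generate.incl)

text \<open>The generating set is stable under conjugation, because the derived subgroup is
  normal.\<close>

lemma (in group) G3_normal: "G3 G \<lhd> G"
  unfolding G3_def commutator_subgroup_def
proof (rule normal_generateI)
  have D: "derived G (carrier G) \<subseteq> carrier G" by (rule derived_in_carrier) simp
  then show "{commutator G h k |h k. h \<in> derived G (carrier G) \<and> k \<in> carrier G} \<subseteq> carrier G"
    by blast
  fix u g assume "u \<in> {commutator G h k |h k. h \<in> derived G (carrier G) \<and> k \<in> carrier G}"
    and g: "g \<in> carrier G"
  then obtain h k where hk: "h \<in> derived G (carrier G)" "k \<in> carrier G" "u = commutator G h k"
    by blast
  have hG: "h \<in> carrier G" using hk D by blast
  have cancel: "inv g \<otimes> (g \<otimes> w) = w" if "w \<in> carrier G" for w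
    using that g by (simp flip: m_assoc)
  have "g \<otimes> u \<otimes> inv g = commutator G (g \<otimes> h \<otimes> inv g) (g \<otimes> k \<otimes> inv g)"
    using hk hG g by (simp add: commutator_def inv_mult_group m_assoc cancel)
  moreover have "g \<otimes> h \<otimes> inv g \<in> derived G (carrier G)"
    using normal.inv_op_closed2[OF derived_self_is_normal g hk(1)] .
  moreover have "g \<otimes> k \<otimes> inv g \<in> carrier G" using g hk by simp
  ultimately show "g \<otimes> u \<otimes> inv g \<in> {commutator G h k |h k. h \<in> derived G (carrier G) \<and> k \<in> carrier G}"
    by blast
qed

lemma (in group) G3_subset_derived: "G3 G \<subseteq> derived G (carrier G)"
  unfolding G3_def commutator_subgroup_def
proof (rule generate_subgroup_incl)
  show "subgroup (derived G (carrier G)) G" by (rule derived_is_subgroup) simp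
  show "{commutator G h k |h k. h \<in> derived G (carrier G) \<and> k \<in> carrier G} \<subseteq> derived G (carrier G)"
    using derived_in_carrier[of "carrier G"] by (auto intro!: commutator_in_derived)
qed

lemma (in class2_pair) derived_generate_subset:
  "derived G (generate G {x, y}) \<subseteq> {c [^] (k::int) | k. True}"
  unfolding derived_def
proof (rule generate_subgroup_incl)
  show "derived_set G (generate G {x, y}) \<subseteq> {c [^] (k::int) | k. True}"
    unfolding generate_eq_nf by (auto simp: nf_mult nf_inv nf_c_pow)
  show "subgroup {c [^] (k::int) | k. True} G"
    using generate_is_subgroup[of "{c}"] generate_pow[of c] by simp
qed

section \<open>\<open>G\<close> as a central extension of \<open>Q\<close> by a group of order
  p\<close>

text \<open>The quotient by \<open>G3 G\<close> is given as a surjection \<open>\<phi>\<close> with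
  that kernel, so that the target can be the presented group itself.\<close>

locale small_G3 = group_hom G Q \<phi> for G (structure) and Q (structure) and \<phi> +
  fixes p :: nat
  assumes p: "Factorial_Ring.prime p"
    and G: "finite_p_group p G"
    and iso: "G\<lparr>carrier := G3 G\<rparr> \<cong> integer_mod_group p"
    and frat: "frattini (G\<lparr>carrier := derived G (carrier G)\<rparr>) = {\<one>}"
    and surj: "\<phi> ` carrier G = carrier Q"
    and ker: "kernel G Q \<phi> = G3 G"
begin

abbreviation "Z \<equiv> G3 G"
abbreviation "D \<equiv> derived G (carrier G)"

lemma fin: "finite (carrier G)"
  by (rule finite_p_groupD(2)[OF G])

lemma subZ: "subgroup Z G"
  by (rule normal_imp_subgroup[OF G.G3_normal])

lemma subD: "subgroup D G"
  by (rule G.derived_is_subgroup) simp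

lemma Z_carrier: "z \<in> Z \<Longrightarrow> z \<in> carrier G"
  by (rule subgroup.mem_carrier[OF subZ])

lemma D_carrier: "h \<in> D \<Longrightarrow> h \<in> carrier G"
  by (rule subgroup.mem_carrier[OF subD])

lemma phi_one_iff: "g \<in> carrier G \<Longrightarrow> \<phi> g = \<one>\<^bsub>Q\<^esub> \<longleftrightarrow> g \<in> Z"
  using ker by (auto simp: kernel_def)

lemma phi_eqD:
  assumes "g \<in> carrier G" "h \<in> carrier G" "\<phi> g = \<phi> h"
  obtains z where "z \<in> Z" "g = z \<otimes> h"
proof -
  have "\<phi> (g \<otimes> inv h) = \<one>\<^bsub>Q\<^esub>" using assms by simp
  then have "g \<otimes> inv h \<in> Z" using assms phi_one_iff[of "g \<otimes> inv h"] by simp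
  moreover have "g = (g \<otimes> inv h) \<otimes> h" using assms by (simp add: G.m_assoc)
  ultimately show ?thesis using that by blast
qed

lemma Z_central: "z \<in> Z \<Longrightarrow> g \<in> carrier G \<Longrightarrow> z \<otimes> g = g \<otimes> z"
  by (rule G.normal_prime_order_central[OF p G G.G3_normal iso])

lemma commutator_in_Z':
  assumes "h \<in> D" "g \<in> carrier G"
  shows "commutator G g h \<in> Z"
  using subgroup.m_inv_closed[OF subZ G.commutator_in_G3[OF assms]] assms
  by (simp add: G.inv_commutator D_carrier)

text \<open>Commutators of \<open>D\<close> with \<open>G\<close> lie in the kernel, so
  \<open>D\<close> has central image in \<open>Q\<close>; this is why \<open>Q\<close> has class at
  most two.\<close>

lemma D_commute_mod:
  assumes "h \<in> D" "g \<in> carrier G"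
  shows "\<phi> h \<otimes>\<^bsub>Q\<^esub> \<phi> g = \<phi> g \<otimes>\<^bsub>Q\<^esub> \<phi> h"
proof -
  have hG: "h \<in> carrier G" using assms(1) by (rule D_carrier)
  have "\<phi> (commutator G h g) = \<one>\<^bsub>Q\<^esub>"
    using G.commutator_in_G3[OF assms] phi_one_iff Z_carrier by blast
  then have "\<phi> (g \<otimes> h \<otimes> commutator G h g) = \<phi> (g \<otimes> h)" using assms hG by simp
  then show ?thesis using G.mult_commutator[OF hG assms(2)] assms hG by (metis hom_mult)
qed

text \<open>\<open>Z\<close> has prime order, so each of its nontrivial elements generates
  it.\<close>

lemma Z_pow: "z \<in> Z \<Longrightarrow> z [^] p = \<one>"
  and Z_subset: "t \<in> Z \<Longrightarrow> t \<noteq> \<one> \<Longrightarrow> subgroup K G \<Longrightarrow> t \<in> K \<Longrightarrow> Z \<subseteq> K"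
  and Z_nontrivial: "Z \<noteq> {\<one>}"
proof -
  obtain d where d: "d \<in> Z" "d \<in> carrier G" and Z_eq: "Z = {d [^] (i::int) | i. True}"
    and ord: "\<And>i::int. d [^] i = \<one> \<longleftrightarrow> int p dvd i"
    by (rule G.cyclic_of_iso_integer_mod_group[OF p subZ iso]) (rule that)
  show "z [^] p = \<one>" if z: "z \<in> Z" for z
  proof -
    obtain i :: int where "z = d [^] i" using z Z_eq by blast
    then have "z [^] int p = d [^] (i * int p)" using d by (simp add: G.int_pow_pow)
    then show ?thesis using ord[of "i * int p"] by (simp add: int_pow_int)
  qed
  show "Z \<subseteq> K" if t: "t \<in> Z" "t \<noteq> \<one>" and K: "subgroup K G" "t \<in> K" for t K
  proof -
    obtain i :: int where i: "t = d [^] i" using t Z_eq by blast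
    then have "\<not> int p dvd i" using t ord by blast
    moreover have "Factorial_Ring.prime (int p)" using p by simp
    ultimately have "coprime (int p) i" by (intro prime_imp_coprime)
    moreover have "d [^] int p \<in> K" using ord[of "int p"] subgroup.one_closed[OF K(1)] by simp
    ultimately have "d \<in> K" using G.int_pow_coprime_mem[OF K(1) d(2)] K(2) i by blast
    then show ?thesis unfolding Z_eq using G.subgroup_int_pow_closed[OF K(1)] by blast
  qed
  have "d \<noteq> \<one>" using ord[of 1] d prime_gt_1_nat[OF p] by simp
  then show "Z \<noteq> {\<one>}" using d by blast
qed

text \<open>Otherwise all the commutators that generate \<open>Z\<close> would be trivial, although
  \<open>Z\<close> has order \<open>p\<close>.\<close>

lemma D_noncentral: "\<exists>h\<in>D. \<exists>g\<in>carrier G. h \<otimes> g \<noteq> g \<otimes> h"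
proof (rule ccontr)
  assume neg: "\<not> (\<exists>h\<in>D. \<exists>g\<in>carrier G. h \<otimes> g \<noteq> g \<otimes> h)"
  have "Z \<subseteq> {\<one>}"
    unfolding G3_def commutator_subgroup_def
    using neg D_carrier G.commutator_eq_one_iff
    by (intro G.generate_subgroup_incl G.triv_subgroup) auto
  then show False using Z_nontrivial subgroup.one_closed[OF subZ] by blast
qed

lemma D_not_subset_Z: "\<not> D \<subseteq> Z"
  using D_noncentral Z_central by blast

text \<open>\<open>Z\<close> consists of non-generators: if \<open>G\<close> is \<open>Z\<close>
  times a subgroup \<open>K\<close>, then centrality of \<open>Z\<close> gives \<open>K\<close> all
  commutators of \<open>G\<close>, and \<open>Z\<close> lies in the derived subgroup.\<close>

lemma generate_lift:
  assumes a: "a \<in> carrier G" and b: "b \<in> carrier G"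
    and gen: "generate Q {\<phi> a, \<phi> b} = carrier Q"
  shows "generate G {a, b} = carrier G"
proof -
  let ?K = "generate G {a, b}"
  have subK: "subgroup ?K G" using a b by (intro G.generate_is_subgroup) auto
  note KG = subgroup.mem_carrier[OF subK]
  have dec: "\<exists>z\<in>Z. \<exists>k\<in>?K. g = z \<otimes> k" if g: "g \<in> carrier G" for g
  proof -
    have "\<phi> g \<in> \<phi> ` ?K"
      using g gen generate_img[of "{a, b}"] a b by auto
    then obtain k where "k \<in> ?K" "\<phi> g = \<phi> k" by blast
    then show ?thesis using phi_eqD[OF g KG] by metis
  qed
  have "derived_set G (carrier G) \<subseteq> ?K"
  proof
    fix u assume "u \<in> derived_set G (carrier G)"
    then obtain g h where gh: "g \<in> carrier G" "h \<in> carrier G" "u = g \<otimes> h \<otimes> inv g \<otimes> inv h"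
      by auto
    obtain z k where zk: "z \<in> Z" "k \<in> ?K" "g = z \<otimes> k" using dec gh by blast
    obtain w l where wl: "w \<in> Z" "l \<in> ?K" "h = w \<otimes> l" using dec gh by blast
    have kl: "k \<in> carrier G" "l \<in> carrier G" "z \<in> carrier G" "w \<in> carrier G"
      using zk wl KG Z_carrier by auto
    \<comment> \<open>Central factors drop out of a commutator, so \<open>g\<close> and
      \<open>h\<close> can be replaced by \<open>k\<close> and \<open>l\<close> from
      \<open>?K\<close>.\<close>
    have conj: "q \<otimes> v \<otimes> inv q = v" if "q \<in> Z" "v \<in> carrier G" for q v
      using that Z_carrier[OF that(1)] Z_central[OF that] by (simp add: G.inv_solve_right')
    have "u = (z \<otimes> (k \<otimes> h \<otimes> inv k) \<otimes> inv z) \<otimes> inv h"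
      using gh kl zk(3) by (simp add: G.inv_mult_group G.m_assoc)
    also have "\<dots> = k \<otimes> (h \<otimes> inv k \<otimes> inv h)"
      using gh kl zk(1) by (simp add: conj) (simp add: G.m_assoc)
    also have "h \<otimes> inv k \<otimes> inv h = w \<otimes> (l \<otimes> inv k \<otimes> inv l) \<otimes> inv w"
      using kl wl(3) by (simp add: G.inv_mult_group G.m_assoc)
    also have "\<dots> = l \<otimes> inv k \<otimes> inv l"
      using kl wl(1) by (simp add: conj)
    finally have "u = k \<otimes> (l \<otimes> inv k \<otimes> inv l)" .
    then show "u \<in> ?K"
      using zk wl by (simp add: subgroup.m_closed[OF subK] subgroup.m_inv_closed[OF subK])
  qed
  then have "D \<subseteq> ?K" unfolding derived_def by (rule G.generate_subgroup_incl[OF _ subK])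
  then have "Z \<subseteq> ?K" using G.G3_subset_derived by blast
  then have "carrier G \<subseteq> ?K" using dec subgroup.m_closed[OF subK] by blast
  then show ?thesis using subgroup.subset[OF subK] by blast
qed

end

section \<open>A generating pair of \<open>G\<close>\<close>

locale small_G3_gens = small_G3 +
  fixes x y
  assumes xG [simp]: "x \<in> carrier G" and yG [simp]: "y \<in> carrier G"
    and gen: "generate G {x, y} = carrier G"
begin

abbreviation "c \<equiv> commutator G x y"

lemma cD: "c \<in> D"
  by (rule G.commutator_in_derived) simp_all

lemma cG [simp]: "c \<in> carrier G"
  by (rule D_carrier[OF cD])

sublocale Qp: class2_pair Q "\<phi> x" "\<phi> y" "\<phi> c"
proof unfold_locales
  show "\<phi> x \<otimes>\<^bsub>Q\<^esub> \<phi> y = \<phi> y \<otimes>\<^bsub>Q\<^esub> \<phi> x \<otimes>\<^bsub>Q\<^esub> \<phi> c"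
    using arg_cong[OF G.mult_commutator[OF xG yG], of \<phi>] by simp
qed (simp_all add: D_commute_mod[OF cD])

lemma genQ: "generate Q {\<phi> x, \<phi> y} = carrier Q"
  using generate_img[of "{x, y}"] gen surj by simp

text \<open>Lifted from the normal form in \<open>Q\<close>. The power of \<open>y\<close> is put
  last, where it supplies representatives of right cosets.\<close>

lemma normal_form:
  assumes g: "g \<in> carrier G"
  obtains z and i k j :: int where "z \<in> Z" "g = z \<otimes> (x [^] i \<otimes> c [^] k \<otimes> y [^] j)"
proof -
  have "\<phi> g \<in> carrier Q" using g by simp
  then obtain i j k where "\<phi> g = Qp.nf i j k" using genQ unfolding Qp.generate_eq_nf by blast
  then have "\<phi> g = \<phi> (x [^] i \<otimes> c [^] k \<otimes> y [^] j)"
    by (simp add: Qp.nf_def hom_int_pow H.m_assoc Qp.cy_pow)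
  then show ?thesis using phi_eqD[OF g] that by (metis G.int_pow_closed G.m_closed cG xG yG)
qed

lemma D_normal_form:
  assumes h: "h \<in> D"
  obtains z and k :: int where "z \<in> Z" "h = z \<otimes> c [^] k"
proof -
  have "\<phi> h \<in> derived Q (\<phi> ` carrier G)" using h derived_img[of "carrier G"] by auto
  then have "\<phi> h \<in> derived Q (generate Q {\<phi> x, \<phi> y})" by (simp only: surj genQ)
  then obtain k :: int where "\<phi> h = \<phi> c [^]\<^bsub>Q\<^esub> k" using Qp.derived_generate_subset by blast
  then have "\<phi> h = \<phi> (c [^] k)" by (simp add: hom_int_pow)
  then show ?thesis using phi_eqD[OF D_carrier[OF h], of "c [^] k"] that by auto
qed

text \<open>\<open>D\<close> is generated by \<open>c\<close> and the central subgroup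
  \<open>Z\<close>.\<close>

lemma D_centralised:
  assumes g: "g \<in> carrier G" and cg: "c \<otimes> g = g \<otimes> c" and h: "h \<in> D"
  shows "h \<otimes> g = g \<otimes> h"
proof -
  obtain z and k :: int where zk: "z \<in> Z" "h = z \<otimes> c [^] k" by (rule D_normal_form[OF h]) (rule that)
  have zG: "z \<in> carrier G" by (rule Z_carrier[OF zk(1)])
  have "c [^] k \<otimes> g = g \<otimes> c [^] k" using G.int_pow_commute[OF cg cG g, of k 1] g by simp
  then show ?thesis
    using zk zG g Z_central[OF zk(1) g] by (metis G.int_pow_closed G.m_assoc cG)
qed

text \<open>If \<open>c\<close> were central, all elements of \<open>G\<close> would be normal forms
  commuting with \<open>c\<close>, and then \<open>D\<close> would be central.\<close>

lemma c_noncentral: "\<not> (c \<otimes> x = x \<otimes> c \<and> c \<otimes> y = y \<otimes> c)"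
proof
  assume comm: "c \<otimes> x = x \<otimes> c \<and> c \<otimes> y = y \<otimes> c"
  interpret P: class2_pair G x y c
    using comm G.mult_commutator[OF xG yG] by unfold_locales simp_all
  have "h \<otimes> g = g \<otimes> h" if h: "h \<in> D" and g: "g \<in> carrier G" for h g
  proof (rule D_centralised[OF g _ h])
    obtain i j k where "g = P.nf i j k" using g unfolding gen[symmetric] P.generate_eq_nf by blast
    then show "c \<otimes> g = g \<otimes> c" 
      using P.nf_mult[of 0 0 1 i j k] P.nf_mult[of i j k 0 0 1] by (simp add: P.nf_c add.commute)
  qed
  then show False using D_noncentral by blast
qed

lemma D_comm:
  assumes "h \<in> D" "k \<in> D"
  shows "h \<otimes> k = k \<otimes> h"
  using D_centralised[OF D_carrier[OF assms(2)] _ assms(1)] D_centralised[OF cG _ assms(2)] by simp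

text \<open>\<open>D\<close> is abelian, so its \<open>p\<close>-th powers lie in its Frattini
  subgroup, which is trivial.\<close>

lemma D_pow:
  assumes h: "h \<in> D"
  shows "h [^] p = \<one>"
proof -
  have "comm_group (G\<lparr>carrier := D\<rparr>)"
    using G.comm_group_subgroup_iff[OF subD] D_comm by blast
  from comm_group.pow_in_frattini[OF this p G.finite_p_group_subgroup[OF p G subD], of h]
  have "h [^]\<^bsub>G\<lparr>carrier := D\<rparr>\<^esub> p = \<one>" using h frat by simp
  then show ?thesis
    using G.int_pow_consistent[OF subD h, of "int p"] by (simp add: int_pow_int)
qed

section \<open>Minimal non-abelian subgroups of small index\<close>

text \<open>The assumption on \<open>w\<close> says that \<open>[g,w] = [g,c]\<close>. This is a
  nontrivial element of \<open>Z\<close>, so it is central of order \<open>p\<close> and generates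
  \<open>Z\<close>. Used with \<open>w = c\<close> and with \<open>w = c y^p\<close>.\<close>

lemma A1_group_generate_outside_centraliser:
  assumes g: "g \<in> carrier G" and nc: "c \<otimes> g \<noteq> g \<otimes> c" and w: "w \<in> carrier G"
    and gw: "g \<otimes> w = w \<otimes> g \<otimes> commutator G g c"
  shows "A1_group p (G\<lparr>carrier := generate G {g, w}\<rparr>)" "Z \<subseteq> generate G {g, w}"
proof -
  let ?t = "commutator G g c"
  have t: "?t \<in> Z" "?t \<in> carrier G" using commutator_in_Z'[OF cD g] g by auto
  have t1: "?t \<noteq> \<one>" using G.commutator_eq_one_iff[OF g cG] nc by metis
  interpret P: class2_pair G g w ?t
    using g w t gw Z_central by unfold_locales auto
  show "A1_group p (G\<lparr>carrier := generate G {g, w}\<rparr>)"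
    by (rule P.A1_group_generate[OF p G t1 Z_pow[OF t(1)]])
  have "?t = P.nf 0 0 1" using t by (simp add: P.nf_def)
  then have "?t \<in> generate G {g, w}" unfolding P.generate_eq_nf by blast
  then show "Z \<subseteq> generate G {g, w}"
    using Z_subset[OF t(1) t1] G.generate_is_subgroup[of "{g, w}"] g w by simp
qed

text \<open>The subgroup generated by \<open>x\<close> and \<open>c\<close> contains
  \<open>Z\<close>, hence \<open>y^p\<close>, so the powers \<open>y^r\<close> with
  \<open>r < p\<close> represent all its cosets.\<close>

lemma A1_subgroup_index_le_p:
  assumes nc: "c \<otimes> x \<noteq> x \<otimes> c" and yp: "y [^] p \<in> Z"
  shows "\<exists>H. subgroup H G \<and> A1_group p (G\<lparr>carrier := H\<rparr>) \<and> card (rcosets H) \<le> p"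
proof -
  let ?H = "generate G {x, c}"
  have sub: "subgroup ?H G" by (rule G.generate_is_subgroup) simp
  note H_mem = subgroup.m_closed[OF sub] G.subgroup_int_pow_closed[OF sub]
  have xH: "x \<in> ?H" and cH: "c \<in> ?H" by (auto intro: generate.incl)
  have A1: "A1_group p (G\<lparr>carrier := ?H\<rparr>)" and ZH: "Z \<subseteq> ?H"
    using A1_group_generate_outside_centraliser[OF xG nc cG G.mult_commutator[OF xG cG]] by simp_all
  have "card (rcosets ?H) \<le> card ((\<lambda>r. y [^] r) ` {..<p})"
  proof (rule G.card_rcosets_le[OF sub])
    fix g assume g: "g \<in> carrier G"
    obtain z and i k j :: int where zk: "z \<in> Z" "g = z \<otimes> (x [^] i \<otimes> c [^] k \<otimes> y [^] j)"
      by (rule normal_form[OF g]) (rule that)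
    let ?r = "nat (j mod int p)" and ?w = "(y [^] p) [^] (j div int p)"
    have p0: "int p > 0" using prime_gt_0_nat[OF p] by simp
    have w: "?w \<in> Z" by (rule G.subgroup_int_pow_closed[OF subZ yp])
    have "y [^] j = y [^] (int p * (j div int p) + j mod int p)" by simp
    also have "\<dots> = ?w \<otimes> y [^] ?r"
      using p0 G.int_pow_pow[OF yG, of "int p" "j div int p"]
      by (subst G.int_pow_mult) (simp_all add: int_pow_int pow_nat)
    finally have "g = (z \<otimes> (x [^] i \<otimes> c [^] k \<otimes> ?w)) \<otimes> y [^] ?r"
      using zk Z_carrier by (simp add: G.m_assoc)
    moreover have "z \<otimes> (x [^] i \<otimes> c [^] k \<otimes> ?w) \<in> ?H"
      by (intro H_mem subsetD[OF ZH w] subsetD[OF ZH zk(1)] xH cH)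
    moreover have "?r < p" using p0 by (simp add: nat_less_iff)
    ultimately show "\<exists>h\<in>?H. \<exists>s\<in>(\<lambda>r. y [^] r) ` {..<p}. g = h \<otimes> s" by blast
  qed auto
  also have "\<dots> \<le> p" using card_image_le[of "{..<p}"] by simp
  finally show ?thesis using sub A1 by blast
qed

text \<open>The subgroup generated by \<open>x\<close> and \<open>c y\<^sup>p\<close>: since \<open>y\<close> centralises \<open>c\<close>, the element \<open>y\<^sup>p\<close>
  commutes with \<open>x\<close>, so the commutator of the two generators is \<open>[x, c]\<close>.\<close>

lemma A1_subgroup_index_le_p2:
  assumes cy: "c \<otimes> y = y \<otimes> c"
  shows "\<exists>H. subgroup H G \<and> A1_group p (G\<lparr>carrier := H\<rparr>) \<and> card (rcosets H) \<le> p\<^sup>2"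
proof -
  have nc: "c \<otimes> x \<noteq> x \<otimes> c" using c_noncentral cy by blast
  let ?w = "c \<otimes> y [^] p"
  let ?H = "generate G {x, ?w}"
  have sub: "subgroup ?H G" by (rule G.generate_is_subgroup) simp
  note H_mem = subgroup.m_closed[OF sub] G.subgroup_int_pow_closed[OF sub]
  have xH: "x \<in> ?H" and wH: "?w \<in> ?H" by (auto intro: generate.incl)
  have cyp: "c \<otimes> y [^] q = y [^] q \<otimes> c" for q :: nat
    using G.int_pow_commute[OF cy cG yG, of 1 "int q"] by (simp add: int_pow_int)
  have xy_pow: "x \<otimes> y [^] q = y [^] q \<otimes> x \<otimes> c [^] q" for q :: nat
  proof (induction q)
    case (Suc q)
    have "x \<otimes> y [^] Suc q = (y [^] q \<otimes> x \<otimes> c [^] q) \<otimes> y" by (simp add: Suc flip: G.m_assoc)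
    also have "\<dots> = y [^] q \<otimes> (x \<otimes> y) \<otimes> c [^] q"
      using G.group_commutes_pow[OF cy cG yG, of q] by (simp add: G.m_assoc)
    also have "\<dots> = y [^] q \<otimes> (y \<otimes> x \<otimes> c) \<otimes> c [^] q"
      by (simp only: G.mult_commutator[OF xG yG])
    also have "\<dots> = y [^] Suc q \<otimes> x \<otimes> c [^] Suc q"
      using G.group_commutes_pow[of c c q] by (simp add: G.m_assoc)
    finally show ?case .
  qed simp
  have xyp: "x \<otimes> y [^] p = y [^] p \<otimes> x" using xy_pow[of p] D_pow[OF cD] by simp
  let ?t = "commutator G x c"
  have t: "?t \<in> Z" by (rule commutator_in_Z'[OF cD xG])
  have "x \<otimes> ?w = c \<otimes> x \<otimes> ?t \<otimes> y [^] p"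
    using G.mult_commutator[OF xG cG] by (simp flip: G.m_assoc)
  also have "\<dots> = c \<otimes> (x \<otimes> y [^] p) \<otimes> ?t"
    using Z_central[OF t, of "y [^] p"] by (simp add: G.m_assoc)
  also have "\<dots> = ?w \<otimes> x \<otimes> ?t" by (simp add: xyp G.m_assoc)
  finally have A1: "A1_group p (G\<lparr>carrier := ?H\<rparr>)" and ZH: "Z \<subseteq> ?H"
    using A1_group_generate_outside_centraliser[OF xG nc, of ?w] by simp_all
  let ?S = "(\<lambda>(s, r). c [^] s \<otimes> y [^] r) ` ({..<p} \<times> {..<p})"
  have "card (rcosets ?H) \<le> card ?S"
  proof (rule G.card_rcosets_le[OF sub])
    fix g assume g: "g \<in> carrier G"
    obtain z and i k j :: int where zk: "z \<in> Z" "g = z \<otimes> (x [^] i \<otimes> c [^] k \<otimes> y [^] j)"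
      by (rule normal_form[OF g]) (rule that)
    \<comment> \<open>For \<open>j = pq + r\<close>, the factor \<open>y^(pq)\<close> equals
      \<open>(c y^p)^q c^(-q)\<close>. It is absorbed into the subgroup, and the representative
      keeps \<open>c^(k - q) y^r\<close>, with the exponent of \<open>c\<close> reduced modulo
      \<open>p\<close>.\<close>
    define q where "q = j div int p"
    let ?r = "nat (j mod int p)" and ?s = "nat ((k - q) mod int p)"
    have p0: "int p > 0" using prime_gt_0_nat[OF p] by simp
    have wq: "?w [^] q = c [^] q \<otimes> y [^] (int p * q)"
      using G.int_pow_mult_distrib[OF cyp[of p], of q] G.int_pow_pow[OF yG, of "int p" q]
      by (simp add: int_pow_int)
    have "y [^] j = y [^] (int p * q + j mod int p)" by (simp add: q_def)
    also have "\<dots> = y [^] (int p * q) \<otimes> y [^] ?r"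
      using p0 by (simp add: G.int_pow_mult pow_nat)
    finally have yj: "y [^] j = y [^] (int p * q) \<otimes> y [^] ?r" .
    have "c [^] (k - q) = c [^] (int p * ((k - q) div int p) + (k - q) mod int p)" by simp
    also have "\<dots> = c [^] ?s"
      using p0 D_pow[OF cD] G.int_pow_pow[OF cG, of "int p" "(k - q) div int p"]
      by (subst G.int_pow_mult) (simp_all add: int_pow_int pow_nat)
    finally have cs: "c [^] (k - q) = c [^] ?s" .
    have "c [^] k \<otimes> y [^] (int p * q) = c [^] (q + (k - q)) \<otimes> y [^] (int p * q)" by simp
    also have "\<dots> = c [^] q \<otimes> (c [^] (k - q) \<otimes> y [^] (int p * q))"
      by (simp only: G.int_pow_mult[OF cG] G.m_assoc G.int_pow_closed cG yG)
    also have "\<dots> = ?w [^] q \<otimes> c [^] ?s"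
      by (simp only: G.int_pow_commute[OF cy cG yG, of "k - q"] wq cs[symmetric] G.m_assoc G.int_pow_closed cG yG)
    finally have "c [^] k \<otimes> y [^] j = ?w [^] q \<otimes> c [^] ?s \<otimes> y [^] ?r"
      by (simp add: yj flip: G.m_assoc)
    then have "g = (z \<otimes> (x [^] i \<otimes> ?w [^] q)) \<otimes> (c [^] ?s \<otimes> y [^] ?r)"
      using zk Z_carrier by (simp add: G.m_assoc)
    moreover have "z \<otimes> (x [^] i \<otimes> ?w [^] q) \<in> ?H"
      by (intro H_mem subsetD[OF ZH zk(1)] xH wH)
    moreover have "?r < p" "?s < p" using p0 by (simp_all add: nat_less_iff)
    then have "c [^] ?s \<otimes> y [^] ?r \<in> ?S" by (intro image_eqI[where x = "(?s, ?r)"]) simp_all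
    ultimately show "\<exists>h\<in>?H. \<exists>s\<in>?S. g = h \<otimes> s" by blast
  qed auto
  also have "\<dots> \<le> p\<^sup>2"
    using card_image_le[of "{..<p} \<times> {..<p}" "\<lambda>(s, r). c [^] s \<otimes> y [^] r"]
    by (simp add: power2_eq_square)
  finally show ?thesis using sub A1 by blast
qed

section \<open>Excluding small indices\<close>

text \<open>Some generator \<open>g\<close> does not commute with \<open>c\<close>, so by minimality
  \<open>g\<close> and \<open>c\<close> would generate \<open>G\<close>. As \<open>[g,c]\<close> is
  central and lies in \<open>Z\<close>, this would put \<open>D\<close> inside
  \<open>Z\<close>.\<close>

lemma not_A1: "\<not> A1_group p G"
proof
  assume A1: "A1_group p G"
  obtain g where g: "g \<in> {x, y}" "c \<otimes> g \<noteq> g \<otimes> c" using c_noncentral by blast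
  then have gG: "g \<in> carrier G" by auto
  let ?K = "generate G {g, c}" and ?t = "commutator G g c"
  have sub: "subgroup ?K G" using gG by (intro G.generate_is_subgroup) simp
  have "g \<in> ?K" "c \<in> ?K" by (auto intro: generate.incl)
  then have K: "?K = carrier G"
    using A1 sub g(2) G.comm_group_subgroup_iff[OF sub] unfolding A1_group_def by metis
  have t: "?t \<in> Z" by (rule commutator_in_Z'[OF cD gG])
  interpret P: class2_pair G g c ?t
    using gG t Z_central Z_carrier G.mult_commutator[OF gG cG] by unfold_locales auto
  have "D \<subseteq> Z"
    using P.derived_generate_subset G.subgroup_int_pow_closed[OF subZ t] unfolding K by blast
  then show False using D_not_subset_Z by blast
qed

end

text \<open>For \<open>n, m \<ge> 2\<close> a subgroup that contains all \<open>p\<close>-th powers and \<open>c\<close> contains the \<open>p\<^sup>3\<close>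
  elements \<open>x\<^bsup>ip^(n-1)\<^esup> y\<^bsup>jp^(m-1)\<^esup> c\<^sup>k\<close>, so it is not an abelian group on two generators.\<close>

lemma (in class2_pair) abelian_subgroup_not_two_generated:
  assumes p: "Factorial_Ring.prime p" and fin: "finite (carrier G)"
    and c1: "c \<noteq> \<one>" and cp: "c [^] p = \<one>"
    and n: "n \<ge> 2" and m: "m \<ge> 2"
    and xn: "x [^] (p ^ n) = \<one>" and ym: "y [^] (p ^ m) = \<one>"
    and indep: "\<And>i j k. nf i j k = \<one> \<Longrightarrow> int (p ^ n) dvd i \<and> int (p ^ m) dvd j"
    and K: "subgroup K G" and comm: "\<And>u v. u \<in> K \<Longrightarrow> v \<in> K \<Longrightarrow> u \<otimes> v = v \<otimes> u"
    and cK: "c \<in> K" and pK: "\<And>g. g \<in> carrier G \<Longrightarrow> g [^] p \<in> K"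
    and uv: "u \<in> K" "v \<in> K"
  shows "generate G {u, v} \<noteq> K"
proof
  assume gen: "generate G {u, v} = K"
  let ?K = "G\<lparr>carrier := K\<rparr>" and ?T = "{g \<in> K. g [^] p = \<one>}"
  have pow_K: "g [^]\<^bsub>?K\<^esub> (q::nat) = g [^] q" if "g \<in> K" for g q
    using int_pow_consistent[OF K that, of "int q"] by (simp add: int_pow_int)
  interpret K: comm_group ?K
    using comm comm_group_subgroup_iff[OF K] by blast
  have "card {g \<in> carrier ?K. g [^]\<^bsub>?K\<^esub> p = \<one>\<^bsub>?K\<^esub>} \<le> p * p"
  proof (rule K.card_torsion_two_generated)
    show "finite (carrier ?K)" using fin subgroup.subset[OF K] finite_subset by auto
    show "generate ?K {u, v} = carrier ?K" using generate_consistent[OF _ K, of "{u, v}"] uv gen by simp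
    show "p > 0" using prime_gt_0_nat[OF p] .
  qed (use uv in simp_all)
  moreover have "{g \<in> carrier ?K. g [^]\<^bsub>?K\<^esub> p = \<one>\<^bsub>?K\<^esub>} = ?T" using pow_K by auto
  ultimately have le: "card ?T \<le> p * p" by simp
  have T_mult: "g \<otimes> h \<in> ?T" if "g \<in> ?T" "h \<in> ?T" for g h
    using that comm subgroup.mem_carrier[OF K] subgroup.m_closed[OF K] by (simp add: pow_mult_distrib)
  have T_pow: "g [^] (int i) \<in> ?T" if "g \<in> ?T" for g i
  proof -
    have "g \<in> carrier G" using that subgroup.mem_carrier[OF K] by blast
    then have "(g [^] i) [^] p = (g [^] p) [^] i" by (simp add: nat_pow_pow mult.commute)
    then show ?thesis
      using that subgroup_int_pow_closed[OF K, of g "int i"] by (simp add: int_pow_int)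
  qed
  \<comment> \<open>As \<open>e \<ge> 2\<close>, the exponent \<open>p^(e-1)\<close> is a multiple
    of \<open>p\<close>; the element is thus a \<open>p\<close>-th power and lies in
    \<open>K\<close>.\<close>
  have root_T: "g [^] (p ^ (e - 1)) \<in> ?T" if g: "g \<in> carrier G" "g [^] (p ^ e) = \<one>" and e: "e \<ge> 2" for g e
  proof -
    obtain d where d: "e = Suc (Suc d)" using e by (metis Suc_le_D numeral_2_eq_2 Suc_le_mono)
    have "g [^] (p ^ (e - 1)) = (g [^] (p ^ d)) [^] p"
      using g by (simp add: d nat_pow_pow mult.commute)
    moreover have "(g [^] (p ^ (e - 1))) [^] p = \<one>"
      using g by (simp add: d nat_pow_pow mult.commute mult.left_commute)
    ultimately show ?thesis using pK[of "g [^] (p ^ d)"] g by simp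
  qed
  let ?f = "\<lambda>(i, j, k). nf (int (p ^ (n - 1) * i)) (int (p ^ (m - 1) * j)) (int k)"
  let ?B = "{..<p} \<times> {..<p} \<times> {..<p}"
  have "?f ` ?B \<subseteq> ?T"
  proof clarify
    fix i j k :: nat
    have "nf (int (p ^ (n - 1) * i)) (int (p ^ (m - 1) * j)) (int k)
        = (x [^] (p ^ (n - 1))) [^] int i \<otimes> (y [^] (p ^ (m - 1))) [^] int j \<otimes> c [^] int k"
      by (simp add: nf_def int_pow_int nat_pow_pow del: of_nat_mult)
    also have "\<dots> \<in> ?T"
      using root_T[OF x_closed xn n] root_T[OF y_closed ym m] cK cp by (intro T_mult T_pow) auto
    finally show "nf (int (p ^ (n - 1) * i)) (int (p ^ (m - 1) * j)) (int k) \<in> K \<and>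
        nf (int (p ^ (n - 1) * i)) (int (p ^ (m - 1) * j)) (int k) [^] p = \<one>" by blast
  qed
  moreover have "inj_on ?f ?B"
  proof (rule inj_onI)
    fix t t' assume "t \<in> ?B" "t' \<in> ?B" and ft: "?f t = ?f t'"
    then obtain i j k i' j' k' where t: "t = (i, j, k)" "t' = (i', j', k')"
      and lt: "i < p" "j < p" "k < p" "i' < p" "j' < p" "k' < p"
      by auto
    then have eq: "nf (int (p ^ (n - 1) * i)) (int (p ^ (m - 1) * j)) (int k)
        = nf (int (p ^ (n - 1) * i')) (int (p ^ (m - 1) * j')) (int k')"
      using ft by simp
    have small: "a = b" if "a < p" "b < p" "int p dvd int a - int b" for a b
      using that by (metis mod_eq_dvd_iff mod_less of_nat_eq_iff zmod_int)
    have cancel: "a = b" if e: "e \<ge> 1" and ab: "a < p" "b < p"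
      and dvd: "int (p ^ e) dvd int (p ^ (e - 1) * a) - int (p ^ (e - 1) * b)" for a b e
    proof -
      obtain d where "e = Suc d" using e by (cases e) auto
      then have "int (p ^ d) * int p dvd int (p ^ d) * (int a - int b)"
        using dvd by (simp add: algebra_simps)
      then show ?thesis using small[OF ab] prime_gt_0_nat[OF p] by simp
    qed
    let ?g = "nf (int (p ^ (n - 1) * i)) (int (p ^ (m - 1) * j)) (int k)"
      and ?g' = "nf (int (p ^ (n - 1) * i')) (int (p ^ (m - 1) * j')) (int k')"
    \<comment> \<open>The quotient is again a normal form; independence compares the exponents of
      \<open>x\<close> and \<open>y\<close> first, after which the powers of \<open>c\<close> can be
      compared.\<close>
    have "?g \<otimes> inv ?g' = \<one>" using eq by simp
    then have "int (p ^ n) dvd int (p ^ (n - 1) * i) - int (p ^ (n - 1) * i') \<and>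
        int (p ^ m) dvd int (p ^ (m - 1) * j) - int (p ^ (m - 1) * j')"
      using indep unfolding nf_inv nf_mult by fastforce
    then have ij: "i = i'" "j = j'"
      using cancel[of n i i'] cancel[of m j j'] n m lt by simp_all
    have "c [^] int k = c [^] int k'"
      using eq unfolding ij nf_def by simp
    then have "c [^] (int k - int k') = \<one>" by (simp add: int_pow_diff)
    moreover have "c [^] int p = \<one>" using cp by (simp add: int_pow_int)
    ultimately have "\<not> coprime (int k - int k') (int p)"
      using int_pow_coprime_mem[OF triv_subgroup c_closed] c1 by blast
    moreover have "Factorial_Ring.prime (int p)" using p by simp
    ultimately have "int p dvd int k - int k'"
      using prime_imp_coprime coprime_commute by blast
    then show "t = t'" using small lt ij t by blast
  qed
  ultimately have "card ?B \<le> card ?T"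
    using fin subgroup.subset[OF K] by (intro card_inj_on_le) (auto intro: finite_subset)
  then have "p * (p * p) \<le> card ?T" by (simp add: card_cartesian_product)
  then have "p * (p * p) \<le> p * p" using le by (rule order_trans)
  then have "p \<le> 1" using prime_gt_0_nat[OF p] by simp
  then show False using prime_gt_1_nat[OF p] by simp
qed

text \<open>The containment of \<open>D\<close> in \<open>H\<close> is reached through
  \<open>Z\<close>. The image of \<open>H\<close> is then a proper subgroup of the minimal
  non-abelian group \<open>Q\<close>, hence abelian; it is two-generated and contains all
  \<open>p\<close>-th powers and the commutator, a contradiction.\<close>

lemma (in small_G3_gens) not_A1_index_p:
  assumes n: "n \<ge> 2" and m: "m \<ge> 2"
    and xn: "\<phi> x [^]\<^bsub>Q\<^esub> (p ^ n) = \<one>\<^bsub>Q\<^esub>" and ym: "\<phi> y [^]\<^bsub>Q\<^esub> (p ^ m) = \<one>\<^bsub>Q\<^esub>"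
    and indep: "\<And>i j k. Qp.nf i j k = \<one>\<^bsub>Q\<^esub> \<Longrightarrow> int (p ^ n) dvd i \<and> int (p ^ m) dvd j"
    and H: "subgroup H G" and A1: "A1_group p (G\<lparr>carrier := H\<rparr>)"
  shows "card (rcosets H) \<noteq> p"
proof
  assume idx: "card (rcosets H) = p"
  have ip: "Factorial_Ring.prime (card (rcosets H))" using p idx by simp
  \<comment> \<open>\<open>Z\<close> is central, so its commutators are trivial; if \<open>Z\<close>
    were not in \<open>H\<close>, then \<open>D\<close>, and with it \<open>Z\<close>, would
    be.\<close>
  have ZH: "Z \<subseteq> H"
  proof (rule ccontr)
    assume nZ: "\<not> Z \<subseteq> H"
    have "commutator G z g \<in> H" if "z \<in> Z" "g \<in> carrier G" for z g
      using that Z_central Z_carrier G.commutator_eq_one_iff subgroup.one_closed[OF H] by metis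
    then have "D \<subseteq> H" by (rule G.prime_index_derived_subset[OF fin H ip G.G3_normal nZ])
    then show False using nZ G.G3_subset_derived by blast
  qed
  \<comment> \<open>The same argument one level up: commutators of \<open>D\<close> with
    \<open>G\<close> lie in \<open>Z\<close>, which is now known to be inside
    \<open>H\<close>.\<close>
  have DH: "D \<subseteq> H"
  proof (rule ccontr)
    assume nD: "\<not> D \<subseteq> H"
    have "commutator G h g \<in> H" if "h \<in> D" "g \<in> carrier G" for h g
      using that ZH G.commutator_in_G3 by blast
    then have "D \<subseteq> H"
      by (rule G.prime_index_derived_subset[OF fin H ip G.derived_self_is_normal nD])
    then show False using nD by blast
  qed
  let ?K = "\<phi> ` H"
  have subK: "subgroup ?K Q" by (rule subgroup_img_is_subgroup[OF H])
  have HG: "h \<in> carrier G" if "h \<in> H" for h using that subgroup.mem_carrier[OF H] by blast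
  have c1: "\<phi> c \<noteq> \<one>\<^bsub>Q\<^esub>"
  proof
    assume "\<phi> c = \<one>\<^bsub>Q\<^esub>"
    then have "c \<in> Z" using phi_one_iff[OF cG] by simp
    then show False using c_noncentral Z_central by simp
  qed
  have cp: "\<phi> c [^]\<^bsub>Q\<^esub> p = \<one>\<^bsub>Q\<^esub>"
    using D_pow[OF cD] hom_nat_pow[OF cG, of p] by simp
  have finQ: "finite (carrier Q)" using fin surj by (metis finite_imageI)
  \<comment> \<open>Identifies the order of \<open>Q\<close> with an index in \<open>G\<close>,
    hence with a power of \<open>p\<close>.\<close>
  have "card (rcosets Z) = order Q"
  proof -
    have "bij_betw (\<lambda>U. the_elem (\<phi> ` U)) (carrier (G Mod Z)) (carrier Q)"
      using FactGroup_iso_set[OF surj] unfolding ker iso_def by blast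
    then show ?thesis by (simp add: bij_betw_same_card order_def FactGroup_def)
  qed
  then have fpQ: "finite_p_group p Q"
    using G.index_primepow[OF p G subZ] finQ H.is_group unfolding finite_p_group_def by metis
  have "A1_group p (Q\<lparr>carrier := carrier Q\<rparr>)"
    using Qp.A1_group_generate[OF p fpQ c1 cp] genQ by simp
  moreover have "?K \<subset> carrier Q"
  proof
    show "?K \<subseteq> carrier Q" using HG by auto
    show "?K \<noteq> carrier Q"
    proof
      assume K: "?K = carrier Q"
      have "g \<in> H" if g: "g \<in> carrier G" for g
      proof -
        have "\<phi> g \<in> ?K" using g K by simp
        then obtain h where h: "h \<in> H" "\<phi> g = \<phi> h" by blast
        obtain z where "z \<in> Z" "g = z \<otimes> h" by (rule phi_eqD[OF g HG[OF h(1)] h(2)]) (rule that)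
        then show ?thesis using h(1) ZH subgroup.m_closed[OF H] by blast
      qed
      then have "H = carrier G" using HG by blast
      then show False using idx G.index_one_iff[OF fin H] prime_gt_1_nat[OF p] by simp
    qed
  qed
  ultimately have comm: "s \<otimes>\<^bsub>Q\<^esub> t = t \<otimes>\<^bsub>Q\<^esub> s" if "s \<in> ?K" "t \<in> ?K" for s t
    using that subK H.A1_group_subgroup_iff[OF p fpQ H.subgroup_self] by blast
  obtain u v where uv: "u \<in> H" "v \<in> H" "H = generate G {u, v}"
    using G.A1_group_generated_by_noncommuting[OF p G H A1] by metis
  have "generate Q {\<phi> u, \<phi> v} = ?K"
    using generate_img[of "{u, v}"] uv HG by simp
  moreover have "generate Q {\<phi> u, \<phi> v} \<noteq> ?K"
  proof (rule Qp.abelian_subgroup_not_two_generated[OF p finQ c1 cp n m xn ym indep subK comm])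
    show "\<phi> c \<in> ?K" using cD DH by blast
    show "q [^]\<^bsub>Q\<^esub> p \<in> ?K" if "q \<in> carrier Q" for q
    proof -
      obtain g where g: "g \<in> carrier G" "q = \<phi> g" using \<open>q \<in> _\<close> surj by blast
      have "g [^] p \<in> H" using G.pow_index_mem[OF H DH g(1)] idx by simp
      then show ?thesis using g hom_nat_pow[of g p] by force
    qed
  qed (use uv in auto)
  ultimately show False by blast
qed

section \<open>Choice of generators\<close>

context small_G3_gens
begin

text \<open>If \<open>y\<close> does not centralise \<open>c\<close>, then \<open>[c,y]\<close>
  generates \<open>Z\<close> and \<open>[c,x]\<close> is its \<open>l\<close>-th power; hence
  \<open>x y^(-l)\<close> centralises \<open>c\<close>, and so all of \<open>D\<close>. Together
  with \<open>y\<close> it still generates \<open>G\<close>.\<close>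

lemma exists_generators_centralised:
  obtains x' y' where "small_G3_gens G Q \<phi> p x' y'"
    "commutator G x' y' \<otimes> y' = y' \<otimes> commutator G x' y'"
proof (cases "c \<otimes> y = y \<otimes> c")
  case True
  then show ?thesis using that small_G3_gens_axioms by blast
next
  case False
  let ?t = "commutator G c y" and ?s = "commutator G c x"
  have tZ: "?t \<in> Z" and sZ: "?s \<in> Z" using G.commutator_in_G3[OF cD] by simp_all
  have t1: "?t \<noteq> \<one>" using False G.commutator_eq_one_iff[OF cG yG] by simp
  have "?s \<in> generate G {?t}"
    using Z_subset[OF tZ t1 G.generate_is_subgroup[of "{?t}"]] sZ by (auto intro: generate.incl)
  then obtain l :: int where l: "?s = ?t [^] l" using G.generate_pow[of ?t] by auto
  interpret P: class2_pair G c y ?t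
    using tZ Z_central Z_carrier G.mult_commutator[OF cG yG] by unfold_locales simp_all
  \<comment> \<open>The exponent \<open>-l\<close> cancels \<open>[c,x]\<close> against a power of
    \<open>[c,y]\<close>.\<close>
  let ?y = "x \<otimes> y [^] (- l)"
  have tG: "?t \<in> carrier G" by (rule Z_carrier[OF tZ])
  have yc: "y [^] (- l) \<otimes> c = c \<otimes> y [^] (- l) \<otimes> ?t [^] l"
    using P.yx_pow[of "-l" 1] by simp
  have ty: "?t [^] l \<otimes> y [^] (- l) = y [^] (- l) \<otimes> ?t [^] l"
    by (rule Z_central[OF G.subgroup_int_pow_closed[OF subZ tZ]]) simp
  have "c \<otimes> ?y = c \<otimes> x \<otimes> y [^] (- l)" by (simp add: G.m_assoc)
  also have "\<dots> = x \<otimes> c \<otimes> ?t [^] l \<otimes> y [^] (- l)"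
    by (simp only: G.mult_commutator[OF cG xG] l)
  also have "\<dots> = x \<otimes> (c \<otimes> y [^] (- l) \<otimes> ?t [^] l)"
    using tG by (simp add: ty G.m_assoc)
  also have "\<dots> = ?y \<otimes> c"
    by (simp only: yc[symmetric]) (simp add: G.m_assoc)
  finally have cy': "c \<otimes> ?y = ?y \<otimes> c" .
  have sub: "subgroup (generate G {y, ?y}) G" by (rule G.generate_is_subgroup) simp
  have y_in: "y \<in> generate G {y, ?y}" "?y \<in> generate G {y, ?y}" by (auto intro: generate.incl)
  have "?y \<otimes> y [^] l = x" by (simp add: G.m_assoc P.int_pow_add)
  then have x_in: "x \<in> generate G {y, ?y}"
    using subgroup.m_closed[OF sub y_in(2) G.subgroup_int_pow_closed[OF sub y_in(1), of l]] by simp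
  have "generate G {x, y} \<subseteq> generate G {y, ?y}"
    using x_in y_in(1) by (intro G.generate_subgroup_incl[OF _ sub]) blast
  then have gen': "generate G {y, ?y} = carrier G" using gen subgroup.subset[OF sub] by simp
  interpret N: small_G3_gens G Q \<phi> p y ?y
    using gen' by unfold_locales simp_all
  show ?thesis
    using that[OF N.small_G3_gens_axioms] D_centralised[OF N.yG cy' N.cD] by blast
qed

end

section \<open>Determination of the minimal index\<close>

text \<open>Indices are powers of \<open>p\<close>, so an upper bound \<open>p^e\<close> is attained
  once all smaller powers are excluded; the exponent is unique because \<open>p > 1\<close>.\<close>

lemma (in group) I_min_eqI:
  assumes p: "Factorial_Ring.prime p" and G: "finite_p_group p G"
    and ex: "\<exists>H. subgroup H G \<and> A1_group p (G\<lparr>carrier := H\<rparr>) \<and> card (rcosets H) \<le> p ^ e"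
    and lower: "\<And>H i. subgroup H G \<Longrightarrow> A1_group p (G\<lparr>carrier := H\<rparr>) \<Longrightarrow> i < e \<Longrightarrow>
      card (rcosets H) \<noteq> p ^ i"
  shows "I_min p G = e"
proof -
  have ge: "p ^ e \<le> card (rcosets H)"
    if H: "subgroup H G" "A1_group p (G\<lparr>carrier := H\<rparr>)" for H
  proof -
    obtain i where i: "card (rcosets H) = p ^ i" by (rule index_primepow[OF p G H(1)]) (rule that)
    then have "e \<le> i" using lower[OF H, of i] by (meson not_le)
    then show ?thesis using i prime_gt_0_nat[OF p] by (simp add: power_increasing)
  qed
  have "min_A1_index p G = p ^ e"
    unfolding min_A1_index_def
  proof (rule Least_equality)
    show "\<exists>H. subgroup H G \<and> A1_group p (G\<lparr>carrier := H\<rparr>) \<and> p ^ e = card (rcosets H)"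
      using ex ge le_antisym by blast
  qed (use ge in blast)
  then show ?thesis
    unfolding I_min_def using prime_gt_1_nat[OF p] by (auto intro!: the_equality)
qed

theorem theorem4p1:
  fixes G :: "('a, 'b) monoid_scheme" and p n m :: nat
  assumes "Factorial_Ring.prime p"
    and "finite_p_group p G"
    and "G\<lparr>carrier := G3 G\<rparr> \<cong> integer_mod_group p"
    and "frattini (G\<lparr>carrier := derived G (carrier G)\<rparr>) = {\<one>\<^bsub>G\<^esub>}"
    and "n \<ge> m" and "m \<ge> 1" and "p = 2 \<Longrightarrow> n > 1"
    and "G Mod (G3 G) \<cong> M_pres p n m"
  shows "(m = 1 \<longrightarrow> I_min p G = 1) \<and> (m \<ge> 2 \<longrightarrow> I_min p G = 2)"
proof -
  note p = assms(1) and G = assms(2)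
  let ?Q = "M_pres p n m"
  interpret G: group G by (rule finite_p_groupD(1)[OF G])
  interpret Z: normal "G3 G" G by (rule G.G3_normal)
  obtain \<psi> where \<psi>: "\<psi> \<in> iso (G Mod G3 G) ?Q" using assms(8) unfolding is_iso_def by blast
  have grQ: "group ?Q" unfolding M_pres_eq by (rule group_presented_group)
  \<comment> \<open>The projection modulo \<open>G3 G\<close> followed by the given
    isomorphism.\<close>
  define \<phi> where "\<phi> = \<psi> \<circ> (\<lambda>g. G3 G #>\<^bsub>G\<^esub> g)"
  have hom: "\<phi> \<in> hom G ?Q"
    unfolding \<phi>_def using \<psi> Z.r_coset_hom_Mod by (intro hom_compose) (auto simp: iso_def)
  interpret \<phi>: group_hom G ?Q \<phi>
    by (intro group_hom.intro group_hom_axioms.intro G.group_axioms grQ hom)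
  have bij: "bij_betw \<psi> (carrier (G Mod G3 G)) (carrier ?Q)" using \<psi> by (simp add: iso_def)
  have surj: "\<phi> ` carrier G = carrier ?Q"
    using bij by (simp add: \<phi>_def bij_betw_def carrier_FactGroup image_comp comp_def)
  have ker: "kernel G ?Q \<phi> = G3 G"
  proof -
    have "\<phi> g = \<one>\<^bsub>?Q\<^esub> \<longleftrightarrow> g \<in> G3 G" if g: "g \<in> carrier G" for g
    proof -
      have "\<phi> g = \<one>\<^bsub>?Q\<^esub> \<longleftrightarrow> \<psi> (G3 G #>\<^bsub>G\<^esub> g) = \<psi> (G3 G #>\<^bsub>G\<^esub> \<one>\<^bsub>G\<^esub>)"
        using \<phi>.hom_one by (simp add: \<phi>_def)
      also have "\<dots> \<longleftrightarrow> G3 G #>\<^bsub>G\<^esub> g = G3 G #>\<^bsub>G\<^esub> \<one>\<^bsub>G\<^esub>"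
        using bij g unfolding bij_betw_def carrier_FactGroup by (metis G.one_closed imageI inj_on_eq_iff)
      also have "\<dots> \<longleftrightarrow> g \<in> G3 G"
        using g Z.subset G.coset_join2[OF g Z.subgroup_axioms] G.rcos_self[OF g Z.subgroup_axioms] by auto
      finally show ?thesis .
    qed
    then show ?thesis using Z.subset by (auto simp: kernel_def)
  qed
  interpret S: small_G3 G ?Q \<phi> p
    using assms surj ker by unfold_locales simp_all
  obtain A B where AB: "A \<in> carrier ?Q" "B \<in> carrier ?Q" "generate ?Q {A, B} = carrier ?Q"
    and An: "A [^]\<^bsub>?Q\<^esub> (p ^ n) = \<one>\<^bsub>?Q\<^esub>" and Bm: "B [^]\<^bsub>?Q\<^esub> (p ^ m) = \<one>\<^bsub>?Q\<^esub>"
    and indep: "\<And>i j k :: int. A [^]\<^bsub>?Q\<^esub> i \<otimes>\<^bsub>?Q\<^esub> B [^]\<^bsub>?Q\<^esub> j \<otimes>\<^bsub>?Q\<^esub> commutator ?Q A B [^]\<^bsub>?Q\<^esub> k = \<one>\<^bsub>?Q\<^esub>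
      \<Longrightarrow> int (p ^ n) dvd i \<and> int (p ^ m) dvd j"
    by (rule M_pres_generators[of p n m]) (rule that)
  obtain a b where ab: "a \<in> carrier G" "b \<in> carrier G" "\<phi> a = A" "\<phi> b = B"
    using AB surj by (metis imageE)
  have gen: "generate G {a, b} = carrier G"
    using S.generate_lift[OF ab(1,2)] AB ab by simp
  interpret P: small_G3_gens G ?Q \<phi> p a b
    using ab gen by unfold_locales
  let ?c = "commutator G a b"
  have index_0: "card (rcosets\<^bsub>G\<^esub> H) \<noteq> p ^ 0"
    if H: "subgroup H G" "A1_group p (G\<lparr>carrier := H\<rparr>)" for H
    using P.not_A1 H G.index_one_iff[OF S.fin H(1)] by auto
  have case1: "I_min p G = 1" if m: "m = 1"
  proof (rule G.I_min_eqI[OF p G])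
    have bp: "b [^]\<^bsub>G\<^esub> p \<in> G3 G"
      using Bm m ab \<phi>.hom_nat_pow[OF ab(2), of p] S.phi_one_iff[of "b [^]\<^bsub>G\<^esub> p"] by simp
    have "\<exists>H. subgroup H G \<and> A1_group p (G\<lparr>carrier := H\<rparr>) \<and> card (rcosets\<^bsub>G\<^esub> H) \<le> p"
    proof (cases "?c \<otimes>\<^bsub>G\<^esub> a = a \<otimes>\<^bsub>G\<^esub> ?c")
      case False
      then show ?thesis by (rule P.A1_subgroup_index_le_p[OF _ bp])
    next
      case True
      then have cb: "?c \<otimes>\<^bsub>G\<^esub> b \<noteq> b \<otimes>\<^bsub>G\<^esub> ?c" using P.c_noncentral by blast
      \<comment> \<open>Here \<open>a\<close> centralises \<open>D\<close> and \<open>b\<close> does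
        not, so \<open>ab\<close> does not either. Replacing \<open>a\<close> by \<open>ab\<close>
        keeps the second generator, whose \<open>p\<close>-th power lies in
        \<open>G3 G\<close>.\<close>
      let ?x = "a \<otimes>\<^bsub>G\<^esub> b"
      have sub: "subgroup (generate G {?x, b}) G" using ab by (intro G.generate_is_subgroup) simp
      have xb: "?x \<in> generate G {?x, b}" "b \<in> generate G {?x, b}" by (auto intro: generate.incl)
      have "?x \<otimes>\<^bsub>G\<^esub> inv\<^bsub>G\<^esub> b \<in> generate G {?x, b}"
        by (rule subgroup.m_closed[OF sub xb(1) subgroup.m_inv_closed[OF sub xb(2)]])
      then have "a \<in> generate G {?x, b}" using ab by (simp add: G.m_assoc)
      then have "generate G {a, b} \<subseteq> generate G {?x, b}"
        using xb(2) by (intro G.generate_subgroup_incl[OF _ sub]) blast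
      then have gen': "generate G {?x, b} = carrier G" using gen subgroup.subset[OF sub] by simp
      interpret N: small_G3_gens G ?Q \<phi> p ?x b
        using ab gen' by unfold_locales simp_all
      have "commutator G ?x b \<otimes>\<^bsub>G\<^esub> ?x \<noteq> ?x \<otimes>\<^bsub>G\<^esub> commutator G ?x b"
      proof
        assume "commutator G ?x b \<otimes>\<^bsub>G\<^esub> ?x = ?x \<otimes>\<^bsub>G\<^esub> commutator G ?x b"
        then have "?c \<otimes>\<^bsub>G\<^esub> ?x = ?x \<otimes>\<^bsub>G\<^esub> ?c" by (rule N.D_centralised[OF N.xG _ P.cD])
        then have "a \<otimes>\<^bsub>G\<^esub> (?c \<otimes>\<^bsub>G\<^esub> b) = a \<otimes>\<^bsub>G\<^esub> (b \<otimes>\<^bsub>G\<^esub> ?c)"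
          using True ab by (metis G.m_assoc P.cG)
        then show False using cb ab by simp
      qed
      then show ?thesis by (rule N.A1_subgroup_index_le_p[OF _ bp])
    qed
    then show "\<exists>H. subgroup H G \<and> A1_group p (G\<lparr>carrier := H\<rparr>) \<and> card (rcosets\<^bsub>G\<^esub> H) \<le> p ^ 1"
      by simp
  qed (use index_0 in simp)
  have case2: "I_min p G = 2" if m: "m \<ge> 2"
  proof (rule G.I_min_eqI[OF p G])
    obtain x y where xy: "small_G3_gens G ?Q \<phi> p x y"
      "commutator G x y \<otimes>\<^bsub>G\<^esub> y = y \<otimes>\<^bsub>G\<^esub> commutator G x y"
      by (rule P.exists_generators_centralised) (rule that)
    show "\<exists>H. subgroup H G \<and> A1_group p (G\<lparr>carrier := H\<rparr>) \<and> card (rcosets\<^bsub>G\<^esub> H) \<le> p\<^sup>2"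
      by (rule small_G3_gens.A1_subgroup_index_le_p2[OF xy])
    fix H i assume H: "subgroup H G" "A1_group p (G\<lparr>carrier := H\<rparr>)" and i: "i < (2::nat)"
    have comm: "\<phi> ?c = commutator ?Q A B" using ab by (simp add: commutator_def)
    have "card (rcosets\<^bsub>G\<^esub> H) \<noteq> p"
    proof (rule P.not_A1_index_p[OF _ m _ _ _ H])
      show "n \<ge> 2" using m assms(5) by simp
      show "\<phi> a [^]\<^bsub>?Q\<^esub> (p ^ n) = \<one>\<^bsub>?Q\<^esub>" "\<phi> b [^]\<^bsub>?Q\<^esub> (p ^ m) = \<one>\<^bsub>?Q\<^esub>"
        using An Bm ab by simp_all
      show "int (p ^ n) dvd i \<and> int (p ^ m) dvd j" if "P.Qp.nf i j k = \<one>\<^bsub>?Q\<^esub>" for i j k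
        using that unfolding P.Qp.nf_def unfolding comm ab by (rule indep)
    qed
    then show "card (rcosets\<^bsub>G\<^esub> H) \<noteq> p ^ i"
      using index_0[OF H] i by (cases i) auto
  qed
  show ?thesis using case1 case2 by blast
qed

end
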